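(* Assume Conjecture (T) (stated in the context). Then the set of all polynomials $D(x_1,\ldots,x_p)$ with integer coefficients ($p\ge 1$ arbitrary) for which the Diophantine equation $D(x_1,\ldots,x_p)=0$ has infinitely many solutions in integers is recursively enumerable, and likewise the set of all such polynomials for which $D(x_1,\ldots,x_p)=0$ has infinitely many solutions in non-negative integers is recursively enumerable.
   Context: For a positive integer $n$, let $E_n=\{x_i=1,\ x_i+x_j=x_k,\ x_i\cdot x_j=x_k:\ i,j,k\in\{1,\ldots,n\}\}$ be the set of all formal equations of these forms in the variables $x_1,\ldots,x_n$ (indices may coincide). A system $S\subseteq E_n$ is solved by a tuple if the tuple satisfies every equation in $S$. Conjecture (T) is the statement: for each positive integer $n$, if a system $S\subseteq E_n$ has only finitely many solutions in integers $x_1,\ldots,x_n$, then each such solution satisfies $|x_1|,\ldots,|x_n|\le 2^{2^{n-1}}$. Polynomials are given to algorithms through a standard effective encoding (number of variables and list of coefficients). *)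

theory Defs
  imports Complex_Main "HOL-Library.FuncSet" "HOL-Library.Nat_Bijection" "HOL-Library.Poly_Mapping"
begin

section \<open>The systems and Conjecture (T)\<close>

text \<open>\<open>One i\<close>, \<open>Add i j k\<close>, \<open>Mult i j k\<close> stand for the formal equations
  \<open>x\<^sub>i = 1\<close>, \<open>x\<^sub>i + x\<^sub>j = x\<^sub>k\<close>, \<open>x\<^sub>i \<cdot> x\<^sub>j = x\<^sub>k\<close>.\<close>

datatype equation = One nat | Add nat nat nat | Mult nat nat nat

definition E :: "nat \<Rightarrow> equation set" where
  "E n = {One i | i. i \<in> {1..n}}
       \<union> {Add i j k | i j k. i \<in> {1..n} \<and> j \<in> {1..n} \<and> k \<in> {1..n}}
       \<union> {Mult i j k | i j k. i \<in> {1..n} \<and> j \<in> {1..n} \<and> k \<in> {1..n}}"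

fun satisfies :: "(nat \<Rightarrow> int) \<Rightarrow> equation \<Rightarrow> bool" where
  "satisfies x (One i) \<longleftrightarrow> x i = 1"
| "satisfies x (Add i j k) \<longleftrightarrow> x i + x j = x k"
| "satisfies x (Mult i j k) \<longleftrightarrow> x i * x j = x k"

text \<open>Integer tuples \<open>(x\<^sub>1, \<dots>, x\<^sub>n)\<close> are extensional functions on \<open>{1..n}\<close>, so that each tuple
  is represented by exactly one function and finiteness of sets of tuples is meaningful.\<close>

definition solutions :: "nat \<Rightarrow> equation set \<Rightarrow> (nat \<Rightarrow> int) set" where
  "solutions n S = {x \<in> {1..n} \<rightarrow>\<^sub>E UNIV. \<forall>e\<in>S. satisfies x e}"

definition Conjecture_T :: bool where
  "Conjecture_T \<longleftrightarrow>
     (\<forall>n\<ge>1. \<forall>S \<subseteq> E n. finite (solutions n S) \<longrightarrow>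
        (\<forall>x \<in> solutions n S. \<forall>i\<in>{1..n}. \<bar>x i\<bar> \<le> 2 ^ (2 ^ (n - 1))))"

section \<open>Polynomials with integer coefficients\<close>

text \<open>A monomial maps each variable index to its exponent; a polynomial maps each monomial to
  its coefficient.\<close>

abbreviation keys where "keys \<equiv> Poly_Mapping.keys"
abbreviation lookup where "lookup \<equiv> Poly_Mapping.lookup"

type_synonym int_mpoly = "(nat \<Rightarrow>\<^sub>0 nat) \<Rightarrow>\<^sub>0 int"

text \<open>The polynomials in the variables \<open>x\<^sub>1, \<dots>, x\<^sub>p\<close>.\<close>

definition polys :: "nat \<Rightarrow> int_mpoly set" where
  "polys p = {D. \<forall>m \<in> keys D. keys m \<subseteq> {1..p}}"

definition eval_poly :: "int_mpoly \<Rightarrow> (nat \<Rightarrow> int) \<Rightarrow> int" where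
  "eval_poly D x = (\<Sum>m\<in>keys D. lookup D m * (\<Prod>i\<in>keys m. x i ^ lookup m i))"

text \<open>The solutions of \<open>D(x\<^sub>1, \<dots>, x\<^sub>p) = 0\<close> with all \<open>x\<^sub>i\<close> in \<open>R\<close>.\<close>

definition zeros :: "nat \<Rightarrow> int set \<Rightarrow> int_mpoly \<Rightarrow> (nat \<Rightarrow> int) set" where
  "zeros p R D = {x \<in> {1..p} \<rightarrow>\<^sub>E R. eval_poly D x = 0}"

text \<open>A term is coded by its exponent vector and its coefficient, and a polynomial by its number
  of variables and the list of codes of its terms with non-zero coefficient. The list is sorted
  so that the code is determined by the polynomial.\<close>

definition term_code :: "nat \<Rightarrow> int_mpoly \<Rightarrow> (nat \<Rightarrow>\<^sub>0 nat) \<Rightarrow> nat" where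
  "term_code p D m =
     prod_encode (list_encode (map (lookup m) [1..<Suc p]), int_encode (lookup D m))"

definition poly_code :: "nat \<Rightarrow> int_mpoly \<Rightarrow> nat" where
  "poly_code p D = prod_encode (p, list_encode (sorted_list_of_set (term_code p D ` keys D)))"

lemma poly_code_inject:
  assumes "D \<in> polys p" "D' \<in> polys p'"
  shows "poly_code p D = poly_code p' D' \<longleftrightarrow> p = p' \<and> D = D'"
proof
  have sub: "lookup A m = lookup B m"
    if A: "A \<in> polys p" and B: "B \<in> polys p"
      and img: "term_code p A ` keys A = term_code p B ` keys B"
      and m: "m \<in> keys A" for A B m
  proof -
    obtain m' where m': "m' \<in> keys B" "term_code p A m = term_code p B m'"
      using img m by blast
    have "map (lookup m) [1..<Suc p] = map (lookup m') [1..<Suc p]"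
      and c: "lookup A m = lookup B m'"
      using m'(2) by (simp_all add: term_code_def list_encode_eq int_encode_eq del: upt_Suc map_eq_conv)
    then have "\<forall>i\<in>{1..p}. lookup m i = lookup m' i"
      by (simp add: atLeastLessThanSuc_atLeastAtMost del: upt_Suc)
    moreover have "keys m \<subseteq> {1..p}" "keys m' \<subseteq> {1..p}"
      using A B m m'(1) unfolding polys_def by blast+
    ultimately have "lookup m i = lookup m' i" for i
      by (metis in_keys_iff subsetD)
    then have "m = m'"
      by (rule poly_mapping_eqI)
    with c show ?thesis by simp
  qed
  assume eq: "poly_code p D = poly_code p' D'"
  then have p: "p' = p"
    by (simp add: poly_code_def)
  have "sorted_list_of_set (term_code p D ` keys D) = sorted_list_of_set (term_code p D' ` keys D')"
    using eq unfolding p poly_code_def by (simp add: list_encode_eq)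
  then have img: "term_code p D ` keys D = term_code p D' ` keys D'"
    by (metis finite_imageI finite_keys set_sorted_list_of_set)
  have "lookup D m = lookup D' m" for m
  proof (cases "m \<in> keys D \<or> m \<in> keys D'")
    case True
    then show ?thesis
      using sub[OF _ _ img, of m] sub[OF _ _ img[symmetric], of m] assms unfolding p by metis
  next
    case False
    then show ?thesis by (simp add: in_keys_iff)
  qed
  with p show "p = p' \<and> D = D'"
    by (simp add: poly_mapping_eqI)
qed simp

section \<open>Recursively enumerable sets\<close>

text \<open>Descriptions of partial recursive functions: the initial functions, composition, primitive
  recursion (on the first argument) and unbounded minimization (over the first argument).\<close>

datatype recf =
    Zero
  | Succ
  | Proj nat
  | Comp recf "recf list"
  | PrimRec recf recf
  | Mu recf

text \<open>\<open>computes f xs y\<close> means that \<open>f\<close> is defined at the arguments \<open>xs\<close> with value \<open>y\<close>.\<close>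

inductive computes :: "recf \<Rightarrow> nat list \<Rightarrow> nat \<Rightarrow> bool" where
  zero: "computes Zero xs 0"
| succ: "computes Succ [x] (Suc x)"
| proj: "i < length xs \<Longrightarrow> computes (Proj i) xs (xs ! i)"
| comp: "length ys = length gs \<Longrightarrow> (\<forall>i<length gs. computes (gs ! i) xs (ys ! i)) \<Longrightarrow>
    computes f ys z \<Longrightarrow> computes (Comp f gs) xs z"
| primrec_0: "computes f xs y \<Longrightarrow> computes (PrimRec f g) (0 # xs) y"
| primrec_Suc: "computes (PrimRec f g) (n # xs) r \<Longrightarrow> computes g (n # r # xs) y \<Longrightarrow>
    computes (PrimRec f g) (Suc n # xs) y"
| mu: "computes f (n # xs) 0 \<Longrightarrow> (\<forall>m<n. \<exists>k>0. computes f (m # xs) k) \<Longrightarrow>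
    computes (Mu f) xs n"

inductive_cases computesE:
  "computes Zero xs y" "computes Succ xs y" "computes (Proj i) xs y" "computes (Comp f gs) xs y"
  "computes (PrimRec f g) (0 # xs) y" "computes (PrimRec f g) (Suc n # xs) y" "computes (Mu f) xs y"

lemma computes_deterministic:
  "computes f xs y \<Longrightarrow> computes f xs y' \<Longrightarrow> y = y'"
proof (induction arbitrary: y' rule: computes.induct)
  case (comp ys gs xs f z)
  from comp.prems obtain ys' where ys': "length ys' = length gs"
    "\<forall>i<length gs. computes (gs ! i) xs (ys' ! i)" "computes f ys' y'"
    by (rule computesE)
  have "ys = ys'"
    using comp.IH(1) comp.hyps(1) ys' by (intro nth_equalityI) auto
  then show ?case using comp.IH(2) ys'(3) by blast
next
  case (mu f n xs)
  from mu.prems have y': "computes f (y' # xs) 0" "\<forall>m<y'. \<exists>k>0. computes f (m # xs) k"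
    by (rule computesE; blast)+
  have "\<not> y' < n" using y'(1) mu.IH(2) by blast
  moreover have "\<not> n < y'" using y'(2) mu.IH(1) by blast
  ultimately show ?case by simp
next
  case (primrec_Suc f g n xs r y)
  from primrec_Suc.prems obtain r' where "computes (PrimRec f g) (n # xs) r'"
    "computes g (n # r' # xs) y'"
    by (rule computesE)
  then show ?case using primrec_Suc.IH by blast
qed (erule computesE; blast)+

text \<open>A set of natural numbers is recursively enumerable iff it is the domain of a unary partial
  recursive function.\<close>

definition rec_enumerable :: "nat set \<Rightarrow> bool" where
  "rec_enumerable A \<longleftrightarrow> (\<exists>f. A = {n. \<exists>y. computes f [n] y})"

end

theory Submission
  imports Defs "HOL-Computational_Algebra.Primes"
begin

text \<open>
  A zero set that is infinite is unbounded, so it contains a zero with an entry larger than any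
  given number. Under Conjecture (T) the converse holds for a suitable number computed from the
  code of the polynomial. To see this, evaluate \<open>D\<close> step by step from its variables, using only the
  constant \<open>1\<close>, sums, differences and products, and give a new variable to each intermediate result.
  Requiring the final result \<open>v\<close> to satisfy \<open>v + v = v\<close> makes \<open>D(x) = 0\<close> into a system
  \<open>S \<subseteq> E n\<close> in which the new variables are functions of the old ones. Thus the solutions of \<open>S\<close>
  correspond one-to-one to the zeros of \<open>D\<close>, and a zero with an entry above \<open>2 ^ (2 ^ (n - 1))\<close>
  forces \<open>S\<close>, hence \<open>D\<close>, to have infinitely many solutions (\<open>large_zero_imp_infinite\<close>).
  Only an upper bound for \<open>n\<close> has to be computed, never the system itself. Exponents,
  coefficients, the number of terms and the number of variables are all at most the code \<open>c\<close>
  of \<open>D\<close>, so a fixed cubic polynomial in \<open>c\<close> bounds \<open>n\<close> (\<open>size_bound\<close>).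

  For non-negative zeros the condition \<open>x\<^sub>i \<ge> 0\<close> has to become an equation over the integers. By
  Lagrange's theorem (\<open>lagrange_four_squares\<close>) it says that \<open>x\<^sub>i\<close> is a sum of four squares. A number has
  only finitely many such representations, so \<open>D\<close> has infinitely many non-negative zeros if and
  only if the enlarged equation has infinitely many integer zeros
  (\<open>large_nonneg_zero_imp_infinite\<close>).

  It follows that a number is in the set in question if and only if it is the code of a polynomial
  for which there is a list of integers that is a zero and has a large entry. This is an unbounded
  search for a witness of a decidable property, hence a recursively enumerable condition
  (\<open>rec_enumerable_projection\<close>). Decidability is established by closure rules for functions
  between types whose values are coded by natural numbers. The coding of lists, pairs and integers
  is chosen such that \<open>poly_code\<close> is literally the code of the pair that consists of the number of
  variables and the list of terms.
\<close>

section \<open>Total recursive functions on argument lists\<close>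

text \<open>The arguments are passed as one list, and only lists of length \<open>k\<close> matter. In this way a term with
  \<open>k\<close> free variables is a function \<open>\<lambda>xs. \<dots>\<close>, and each function symbol in it needs one closure rule.\<close>
definition rec_fun :: "nat \<Rightarrow> (nat list \<Rightarrow> nat) \<Rightarrow> bool" where
  "rec_fun k f \<longleftrightarrow> (\<exists>r. \<forall>xs. length xs = k \<longrightarrow> computes r xs (f xs))"

lemma rec_fun_cong:
  assumes "rec_fun k f" "\<And>xs. length xs = k \<Longrightarrow> f xs = g xs"
  shows "rec_fun k g"
  using assms unfolding rec_fun_def by metis

lemma rec_fun_zero: "rec_fun k (\<lambda>_. 0)"
  unfolding rec_fun_def using computes.zero by blast

lemma rec_fun_proj: "i < k \<Longrightarrow> rec_fun k (\<lambda>xs. xs ! i)"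
  unfolding rec_fun_def using computes.proj by blast

lemma rec_fun_comp:
  assumes f: "rec_fun (length gs) f" and gs: "\<forall>g\<in>set gs. rec_fun k g"
  shows "rec_fun k (\<lambda>xs. f (map (\<lambda>g. g xs) gs))"
proof -
  obtain rf where rf: "\<And>xs. length xs = length gs \<Longrightarrow> computes rf xs (f xs)"
    using f unfolding rec_fun_def by blast
  have "\<forall>g\<in>set gs. \<exists>r. \<forall>xs. length xs = k \<longrightarrow> computes r xs (g xs)"
    using gs unfolding rec_fun_def by blast
  then obtain R where R: "\<And>g xs. g \<in> set gs \<Longrightarrow> length xs = k \<Longrightarrow> computes (R g) xs (g xs)"
    by (auto dest!: bchoice)
  have "computes (Comp rf (map R gs)) xs (f (map (\<lambda>g. g xs) gs))" if "length xs = k" for xs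
    by (rule computes.comp[where ys = "map (\<lambda>g. g xs) gs"]) (use that R rf in auto)
  then show ?thesis unfolding rec_fun_def by blast
qed

lemma rec_fun_comp1:
  assumes "rec_fun 1 (\<lambda>xs. f (xs ! 0))" "rec_fun k g"
  shows "rec_fun k (\<lambda>xs. f (g xs))"
  using rec_fun_comp[of "[g]" "\<lambda>xs. f (xs ! 0)" k] assms by simp

lemma rec_fun_comp3:
  assumes "rec_fun 3 (\<lambda>xs. f (xs ! 0) (xs ! 1) (xs ! 2))" "rec_fun k g" "rec_fun k h" "rec_fun k i"
  shows "rec_fun k (\<lambda>xs. f (g xs) (h xs) (i xs))"
  using rec_fun_comp[of "[g, h, i]" "\<lambda>xs. f (xs ! 0) (xs ! 1) (xs ! 2)" k] assms
  by (simp add: numeral_3_eq_3)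

lemma rec_fun_Suc:
  assumes "rec_fun k g" shows "rec_fun k (\<lambda>xs. Suc (g xs))"
proof (rule rec_fun_comp1[OF _ assms])
  have "computes Succ xs (Suc (xs ! 0))" if "length xs = 1" for xs
    using that computes.succ by (cases xs) auto
  then show "rec_fun 1 (\<lambda>xs. Suc (xs ! 0))" unfolding rec_fun_def by blast
qed

lemma rec_fun_const: "rec_fun k (\<lambda>_. c)"
  by (induction c) (auto intro: rec_fun_zero rec_fun_Suc)

text \<open>\<open>PrimRec\<close> recurses on the head of the argument list. To recurse on a computed number \<open>m xs\<close> instead,
  it is composed with the list of functions \<open>m\<close>, followed by all projections.\<close>
lemma rec_fun_rec:
  assumes b: "rec_fun k b" and s: "rec_fun (k + 2) (\<lambda>xs. s (xs ! 0) (xs ! 1) (drop 2 xs))"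
    and m: "rec_fun k m"
  shows "rec_fun k (\<lambda>xs. rec_nat (b xs) (\<lambda>n r. s n r xs) (m xs))"
proof -
  obtain rb where rb: "\<And>xs. length xs = k \<Longrightarrow> computes rb xs (b xs)"
    using b unfolding rec_fun_def by blast
  obtain rs where rs: "\<And>xs. length xs = k + 2 \<Longrightarrow> computes rs xs (s (xs ! 0) (xs ! 1) (drop 2 xs))"
    using s unfolding rec_fun_def by blast
  have "computes (PrimRec rb rs) (n # xs) (rec_nat (b xs) (\<lambda>n r. s n r xs) n)"
    if "length xs = k" for n xs
  proof (induction n)
    case 0
    then show ?case by (simp add: computes.primrec_0 rb that)
  next
    case (Suc n)
    show ?case
      using computes.primrec_Suc[OF Suc] rs[of "n # rec_nat (b xs) (\<lambda>n r. s n r xs) n # xs"] that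
      by simp
  qed
  then have "computes (PrimRec rb rs) xs (rec_nat (b (tl xs)) (\<lambda>n r. s n r (tl xs)) (hd xs))"
    if "length xs = Suc k" for xs
    using that by (cases xs) auto
  then have "rec_fun (Suc k) (\<lambda>xs. rec_nat (b (tl xs)) (\<lambda>n r. s n r (tl xs)) (hd xs))"
    unfolding rec_fun_def by blast
  then have "rec_fun k (\<lambda>xs. (\<lambda>xs. rec_nat (b (tl xs)) (\<lambda>n r. s n r (tl xs)) (hd xs))
      (map (\<lambda>g. g xs) (m # map (\<lambda>i xs. xs ! i) [0..<k])))"
    by (intro rec_fun_comp) (auto intro: m rec_fun_proj)
  then show ?thesis
  proof (rule rec_fun_cong)
    fix xs :: "nat list" assume "length xs = k"
    then have "map (\<lambda>i. xs ! i) [0..<k] = xs" by (metis map_nth)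
    then show "(\<lambda>xs. rec_nat (b (tl xs)) (\<lambda>n r. s n r (tl xs)) (hd xs))
      (map (\<lambda>g. g xs) (m # map (\<lambda>i xs. xs ! i) [0..<k])) =
      rec_nat (b xs) (\<lambda>n r. s n r xs) (m xs)"
      by (simp add: comp_def)
  qed
qed

lemma rec_fun_plus:
  assumes "rec_fun k f" "rec_fun k g" shows "rec_fun k (\<lambda>xs. f xs + g xs)"
proof -
  have "rec_nat m (\<lambda>_ r. Suc r) n = m + n" for m n by (induction n) auto
  moreover have "rec_fun k (\<lambda>xs. rec_nat (f xs) (\<lambda>_ r. Suc r) (g xs))"
    by (rule rec_fun_rec) (auto intro: assms rec_fun_proj rec_fun_Suc)
  ultimately show ?thesis by simp
qed

lemma rec_fun_pred:
  assumes "rec_fun k f" shows "rec_fun k (\<lambda>xs. f xs - 1)"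
proof -
  have "rec_nat 0 (\<lambda>n _. n) n = n - 1" for n by (induction n) auto
  moreover have "rec_fun k (\<lambda>xs. rec_nat 0 (\<lambda>n _. n) (f xs))"
    by (rule rec_fun_rec) (auto intro: assms rec_fun_proj rec_fun_const)
  ultimately show ?thesis by simp
qed

lemma rec_fun_minus:
  assumes "rec_fun k f" "rec_fun k g" shows "rec_fun k (\<lambda>xs. f xs - g xs)"
proof -
  have "rec_nat m (\<lambda>_ r. r - 1) n = m - n" for m n by (induction n) auto
  moreover have "rec_fun k (\<lambda>xs. rec_nat (f xs) (\<lambda>_ r. r - 1) (g xs))"
    by (rule rec_fun_rec) (rule assms rec_fun_proj rec_fun_pred | simp)+
  ultimately show ?thesis by simp
qed

text \<open>A case distinction is a recursion whose step ignores the counter and the previous value.\<close>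
lemma rec_fun_ifz:
  assumes "rec_fun k f" "rec_fun k g" "rec_fun k h"
  shows "rec_fun k (\<lambda>xs. if f xs = 0 then g xs else h xs)"
proof (rule rec_fun_comp3[OF _ assms])
  have eq: "rec_nat a (\<lambda>_ _. b) n = (if n = 0 then a else b)" for a b n :: nat
    by (induction n) auto
  have "rec_fun 5 (\<lambda>xs. drop 2 xs ! 2)"
    by (rule rec_fun_cong[OF rec_fun_proj[of 4]]) auto
  then have "rec_fun 3 (\<lambda>xs. rec_nat (xs ! 1) (\<lambda>_ _. xs ! 2) (xs ! 0))"
    by (intro rec_fun_rec) (auto intro: rec_fun_proj)
  then show "rec_fun 3 (\<lambda>xs. if xs ! 0 = 0 then xs ! 1 else xs ! 2)"
    by (simp only: eq)
qed

lemma rec_fun_ifle: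
  assumes "rec_fun k f" "rec_fun k f'" "rec_fun k g" "rec_fun k h"
  shows "rec_fun k (\<lambda>xs. if f xs \<le> f' xs then g xs else h xs)"
  using rec_fun_ifz[OF rec_fun_minus[OF assms(1,2)] assms(3,4)] by simp

lemma rec_fun_triangle:
  assumes "rec_fun k f" shows "rec_fun k (\<lambda>xs. triangle (f xs))"
proof -
  have "rec_nat 0 (\<lambda>n r. r + Suc n) n = triangle n" for n by (induction n) auto
  moreover have "rec_fun k (\<lambda>xs. rec_nat 0 (\<lambda>n r. r + Suc n) (f xs))"
    by (rule rec_fun_rec) (rule assms rec_fun_proj rec_fun_const rec_fun_plus rec_fun_Suc | simp)+
  ultimately show ?thesis by simp
qed

lemma rec_fun_prod_encode:
  assumes "rec_fun k f" "rec_fun k g" shows "rec_fun k (\<lambda>xs. prod_encode (f xs, g xs))"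
  by (simp add: prod_encode_def) (intro rec_fun_plus rec_fun_triangle assms)

text \<open>The inverse of \<open>triangle\<close>, rounded down. It grows by at most one when its argument does, which
  makes it primitive recursive.\<close>
definition triangle_root :: "nat \<Rightarrow> nat" where
  "triangle_root = rec_nat 0 (\<lambda>n s. if triangle (Suc s) \<le> Suc n then Suc s else s)"

lemma triangle_root_bounds: "triangle (triangle_root n) \<le> n \<and> n < triangle (Suc (triangle_root n))"
  by (induction n) (auto simp: triangle_root_def)

lemma triangle_mono: "m \<le> n \<Longrightarrow> triangle m \<le> triangle n"
  by (induction n) (auto simp: le_Suc_eq)

text \<open>The code of \<open>(a, b)\<close> lies between consecutive triangular numbers, those of \<open>a + b\<close> and its
  successor. Hence the sum, and from it both components, can be read off.\<close>
lemma triangle_root_prod_encode: "triangle_root (prod_encode (a, b)) = a + b"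
proof -
  let ?n = "prod_encode (a, b)"
  have "triangle (a + b) \<le> ?n" "?n < triangle (Suc (a + b))"
    by (auto simp: prod_encode_def)
  then show ?thesis
    using triangle_root_bounds[of ?n] triangle_mono[of "Suc (a + b)" "triangle_root ?n"]
      triangle_mono[of "Suc (triangle_root ?n)" "a + b"]
    by (meson not_less_eq_eq le_less_trans not_le order_antisym)
qed

lemma fst_prod_decode: "fst (prod_decode n) = n - triangle (triangle_root n)"
proof -
  obtain a b where "n = prod_encode (a, b)" by (metis prod_decode_inverse surj_pair)
  then show ?thesis by (simp add: triangle_root_prod_encode) (simp add: prod_encode_def)
qed

lemma snd_prod_decode: "snd (prod_decode n) = triangle_root n - fst (prod_decode n)"
proof -
  obtain a b where "n = prod_encode (a, b)" by (metis prod_decode_inverse surj_pair)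
  then show ?thesis by (simp add: triangle_root_prod_encode)
qed

lemma rec_fun_triangle_root:
  assumes "rec_fun k f" shows "rec_fun k (\<lambda>xs. triangle_root (f xs))"
  unfolding triangle_root_def
  by (rule rec_fun_rec)
    (rule assms rec_fun_proj rec_fun_const rec_fun_ifle rec_fun_triangle rec_fun_Suc | simp del: triangle_Suc)+

lemma rec_fun_fst:
  assumes "rec_fun k f" shows "rec_fun k (\<lambda>xs. fst (prod_decode (f xs)))"
  unfolding fst_prod_decode by (intro assms rec_fun_minus rec_fun_triangle rec_fun_triangle_root)

lemma rec_fun_snd:
  assumes "rec_fun k f" shows "rec_fun k (\<lambda>xs. snd (prod_decode (f xs)))"
  unfolding snd_prod_decode by (intro assms rec_fun_minus rec_fun_fst rec_fun_triangle_root)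

section \<open>Computable functions between coded types\<close>

text \<open>The coding is onto, so every natural number is the code of some value. Functions on codes are
  therefore total without a convention for invalid codes, and a search through the natural numbers
  is a search through all values.\<close>
class codable =
  fixes code :: "'a \<Rightarrow> nat"
  assumes bij_code: "bij code"

lemma code_eq [simp]: "code x = code y \<longleftrightarrow> x = y" for x y :: "'a::codable"
  by (metis bij_code bij_def injD)

instantiation nat :: codable
begin
definition "code (n::nat) = n"
instance by standard (simp add: code_nat_def bij_def inj_def surj_def)
end

instantiation int :: codable
begin
definition "code = int_encode"
instance by standard (simp add: code_int_def bij_int_encode)
end

instantiation prod :: (codable, codable) codable
begin
definition "code = prod_encode \<circ> map_prod code code"
instance
proof
  have "bij (map_prod code code :: 'a \<times> 'b \<Rightarrow> _)"
    using bij_betw_map_prod[OF bij_code bij_code] by simp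
  then show "bij (code :: 'a \<times> 'b \<Rightarrow> nat)"
    unfolding code_prod_def by (rule bij_comp) (rule bij_prod_encode)
qed
end

instantiation list :: (codable) codable
begin
definition "code xs = list_encode (map code xs)"
instance
proof
  have "bij (map code :: 'a list \<Rightarrow> _)"
    unfolding bij_def using bij_is_inj[OF bij_code] surj_f_inv_f[OF bij_is_surj[OF bij_code]]
    by (auto intro!: surjI[of _ "map (inv code)"] map_idI simp: comp_def)
  then have "bij (list_encode \<circ> (map code :: 'a list \<Rightarrow> _))"
    by (rule bij_comp) (rule bij_list_encode)
  then show "bij (code :: 'a list \<Rightarrow> nat)"
    by (simp add: code_list_def[abs_def] comp_def)
qed
end

lemma code_Pair [simp]: "code (x, y) = prod_encode (code x, code y)"
  by (simp add: code_prod_def)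

lemma code_Nil [simp]: "code ([]::'a::codable list) = 0"
  by (simp add: code_list_def)

text \<open>The successor of a pair code: the decomposition of a non-empty list costs one predecessor and
  yields the code of the pair of head and tail.\<close>
lemma code_Cons [simp]: "code (x # xs) = Suc (code (x, xs))"
  by (simp add: code_list_def)

lemma code_nat [simp]: "code (n::nat) = n"
  by (simp add: code_nat_def)

definition computable :: "('a::codable \<Rightarrow> 'b::codable) \<Rightarrow> bool" where
  "computable f \<longleftrightarrow> (\<exists>h. rec_fun (Suc 0) (\<lambda>xs. h (xs ! 0)) \<and> (\<forall>x. code (f x) = h (code x)))"

lemma computableI:
  assumes "rec_fun (Suc 0) (\<lambda>xs. h (xs ! 0))" "\<And>x. code (f x) = h (code x)"
  shows "computable f"
  using assms unfolding computable_def by blast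

lemma computableE:
  assumes "computable f"
  obtains h where "\<And>k g. rec_fun k g \<Longrightarrow> rec_fun k (\<lambda>xs. h (g xs))" "\<And>x. code (f x) = h (code x)"
proof -
  obtain h where "rec_fun (Suc 0) (\<lambda>xs. h (xs ! 0))" "\<And>x. code (f x) = h (code x)"
    using assms unfolding computable_def by blast
  then show ?thesis using that[of h] rec_fun_comp1[of h] by simp
qed

named_theorems computable

lemma rec_fun_arg: "rec_fun (Suc 0) (\<lambda>xs. xs ! 0)"
  by (simp add: rec_fun_proj)

lemma computable_lift1:
  assumes f: "computable f" and H: "\<And>k u. rec_fun k u \<Longrightarrow> rec_fun k (\<lambda>xs. H (u xs))"
    and eq: "\<And>x. code (F x) = H (code (f x))"
  shows "computable F"
proof -
  obtain hf where hf: "\<And>k g. rec_fun k g \<Longrightarrow> rec_fun k (\<lambda>xs. hf (g xs))"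
    and hf': "\<And>x. code (f x) = hf (code x)"
    by (rule computableE[OF f]) iprover
  have "rec_fun (Suc 0) (\<lambda>xs. H (hf (xs ! 0)))"
    by (intro H hf rec_fun_arg)
  then show ?thesis by (rule computableI) (simp add: eq hf')
qed

lemma computable_lift2:
  assumes f: "computable f" and g: "computable g"
    and H: "\<And>k u v. rec_fun k u \<Longrightarrow> rec_fun k v \<Longrightarrow> rec_fun k (\<lambda>xs. H (u xs) (v xs))"
    and eq: "\<And>x. code (F x) = H (code (f x)) (code (g x))"
  shows "computable F"
proof -
  obtain hf where hf: "\<And>k g. rec_fun k g \<Longrightarrow> rec_fun k (\<lambda>xs. hf (g xs))"
    and hf': "\<And>x. code (f x) = hf (code x)"
    by (rule computableE[OF f]) iprover
  obtain hg where hg: "\<And>k g. rec_fun k g \<Longrightarrow> rec_fun k (\<lambda>xs. hg (g xs))"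
    and hg': "\<And>x. code (g x) = hg (code x)"
    by (rule computableE[OF g]) iprover
  have "rec_fun (Suc 0) (\<lambda>xs. H (hf (xs ! 0)) (hg (xs ! 0)))"
    by (intro H hf hg rec_fun_arg)
  then show ?thesis by (rule computableI) (simp add: eq hf' hg')
qed

lemma computable_id [computable]: "computable (\<lambda>x. x)"
  by (rule computableI[OF rec_fun_arg]) simp

lemma computable_const [computable]: "computable (\<lambda>_. c)"
  by (rule computableI[OF rec_fun_const]) simp

lemma computable_code [computable]:
  assumes "computable f" shows "computable (\<lambda>x. code (f x))"
  using assms unfolding computable_def by simp

lemma computable_Pair [computable]:
  assumes "computable f" "computable g" shows "computable (\<lambda>x. (f x, g x))"
  by (rule computable_lift2[OF assms rec_fun_prod_encode]) auto

lemma computable_fst [computable]: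
  assumes "computable f" shows "computable (\<lambda>x. fst (f x))"
  by (rule computable_lift1[OF assms rec_fun_fst]) (auto simp: code_prod_def)

lemma computable_snd [computable]:
  assumes "computable f" shows "computable (\<lambda>x. snd (f x))"
  by (rule computable_lift1[OF assms rec_fun_snd]) (auto simp: code_prod_def)

lemma computable_comp:
  assumes "computable f" "computable g" shows "computable (\<lambda>x. f (g x))"
proof -
  obtain h where "\<And>k g. rec_fun k g \<Longrightarrow> rec_fun k (\<lambda>xs. h (g xs))" "\<And>x. code (f x) = h (code x)"
    by (rule computableE[OF assms(1)]) iprover
  then show ?thesis by (intro computable_lift1[OF assms(2), of h])
qed

text \<open>The step is a function of the environment \<open>x\<close>, the counter and the previous value, tupled in this
  order. All rules for variable-binding constructs extend the environment by pairing. This makes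
  them applicable by higher-order unification, so that the computability of a term follows by
  decomposing it along its syntax.\<close>
lemma computable_rec_nat [computable]:
  assumes "computable b" "computable (\<lambda>z. s (fst z) (fst (snd z)) (snd (snd z)))" "computable m"
  shows "computable (\<lambda>x. rec_nat (b x) (s x) (m x))"
proof -
  obtain hb where hb: "\<And>k g. rec_fun k g \<Longrightarrow> rec_fun k (\<lambda>xs. hb (g xs))" "\<And>x. code (b x) = hb (code x)"
    by (rule computableE[OF assms(1)]) iprover
  obtain hs where hs: "\<And>k g. rec_fun k g \<Longrightarrow> rec_fun k (\<lambda>xs. hs (g xs))"
    and hs': "\<And>z. code (s (fst z) (fst (snd z)) (snd (snd z))) = hs (code z)"
    by (rule computableE[OF assms(2)]) iprover
  obtain hm where hm: "\<And>k g. rec_fun k g \<Longrightarrow> rec_fun k (\<lambda>xs. hm (g xs))" "\<And>x. code (m x) = hm (code x)"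
    by (rule computableE[OF assms(3)]) iprover
  have s: "code (s x n r) = hs (prod_encode (code x, prod_encode (n, code r)))" for x n r
    using hs'[of "(x, n, r)"] by simp
  have *: "code (rec_nat b (s x) n) =
      rec_nat (code b) (\<lambda>n r. hs (prod_encode (code x, prod_encode (n, r)))) n" for x b n
    by (induction n) (simp_all add: s)
  have "rec_fun (Suc (Suc (Suc 0))) (\<lambda>xs. drop 2 xs ! 0)"
    by (rule rec_fun_cong[OF rec_fun_proj[of 2]]) auto
  then have "rec_fun (Suc 0) (\<lambda>xs. rec_nat (hb (xs ! 0))
      (\<lambda>n r. hs (prod_encode (xs ! 0, prod_encode (n, r)))) (hm (xs ! 0)))"
    by (intro rec_fun_rec hb hs hm rec_fun_arg rec_fun_prod_encode rec_fun_proj) auto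
  then show ?thesis
    by (rule computableI) (use * hb hm in auto)
qed

lemma computable_Suc [computable]: "computable f \<Longrightarrow> computable (\<lambda>x. Suc (f x))"
  by (erule computable_lift1[OF _ rec_fun_Suc]) auto

lemma computable_plus [computable]:
  fixes f g :: "_ \<Rightarrow> nat"
  assumes "computable f" "computable g" shows "computable (\<lambda>x. f x + g x)"
proof -
  have "rec_nat m (\<lambda>_ r. Suc r) n = m + n" for m n by (induction n) auto
  moreover have "computable (\<lambda>x. rec_nat (f x) (\<lambda>_ r. Suc r) (g x))"
    by (intro computable assms)
  ultimately show ?thesis by simp
qed

lemma computable_minus [computable]:
  fixes f g :: "_ \<Rightarrow> nat"
  assumes "computable f" "computable g" shows "computable (\<lambda>x. f x - g x)"
proof -
  have p: "rec_nat 0 (\<lambda>n _. n) n = n - 1" for n by (induction n) auto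
  have "rec_nat m (\<lambda>_ r. rec_nat 0 (\<lambda>n _. n) r) n = m - n" for m n by (induction n) (auto simp: p)
  moreover have "computable (\<lambda>x. rec_nat (f x) (\<lambda>_ r. rec_nat 0 (\<lambda>n _. n) r) (g x))"
    by (intro computable assms)
  ultimately show ?thesis by simp
qed

lemma computable_times [computable]:
  fixes f g :: "_ \<Rightarrow> nat"
  assumes "computable f" "computable g" shows "computable (\<lambda>x. f x * g x)"
proof -
  have "rec_nat 0 (\<lambda>_ r. r + m) n = m * n" for m n :: nat by (induction n) auto
  moreover have "computable (\<lambda>x. rec_nat 0 (\<lambda>_ r. r + f x) (g x))"
    by (intro computable assms computable_comp[OF assms(1)])
  ultimately show ?thesis by simp
qed

lemma computable_power_nat [computable]:
  fixes f g :: "_ \<Rightarrow> nat"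
  assumes "computable f" "computable g" shows "computable (\<lambda>x. f x ^ g x)"
proof -
  have "rec_nat 1 (\<lambda>_ r. r * m) n = m ^ n" for m n :: nat by (induction n) auto
  moreover have "computable (\<lambda>x. rec_nat 1 (\<lambda>_ r. r * f x) (g x))"
    by (intro computable assms computable_comp[OF assms(1)])
  ultimately show ?thesis by simp
qed

text \<open>Truth values have no bijective coding by natural numbers; predicates are represented by their
  characteristic functions instead.\<close>
definition decidable :: "('a::codable \<Rightarrow> bool) \<Rightarrow> bool" where
  "decidable P \<longleftrightarrow> computable (\<lambda>x. of_bool (P x) :: nat)"

lemma computable_if [computable]:
  assumes "decidable P" "computable f" "computable g"
  shows "computable (\<lambda>x. if P x then f x else g x)"
proof -
  obtain hp where hp: "\<And>k g. rec_fun k g \<Longrightarrow> rec_fun k (\<lambda>xs. hp (g xs))" "\<And>x. code (of_bool (P x)::nat) = hp (code x)"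
    by (rule computableE[OF assms(1)[unfolded decidable_def]]) iprover
  obtain hf where hf: "\<And>k g. rec_fun k g \<Longrightarrow> rec_fun k (\<lambda>xs. hf (g xs))" "\<And>x. code (f x) = hf (code x)"
    by (rule computableE[OF assms(2)]) iprover
  obtain hg where hg: "\<And>k g. rec_fun k g \<Longrightarrow> rec_fun k (\<lambda>xs. hg (g xs))" "\<And>x. code (g x) = hg (code x)"
    by (rule computableE[OF assms(3)]) iprover
  have "rec_fun (Suc 0) (\<lambda>xs. if hp (xs ! 0) = 0 then hg (xs ! 0) else hf (xs ! 0))"
    by (intro hp(1) hf(1) hg(1) rec_fun_ifz rec_fun_arg)
  moreover have "hp (code x) = of_bool (P x)" for x
    using hp(2)[of x] by simp
  then have "code (if P x then f x else g x) = (if hp (code x) = 0 then hg (code x) else hf (code x))" for x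
    by (simp add: hf(2) hg(2))
  ultimately show ?thesis by (rule computableI)
qed

lemma decidable_comp: "decidable P \<Longrightarrow> computable f \<Longrightarrow> decidable (\<lambda>x. P (f x))"
  unfolding decidable_def by (rule computable_comp)

lemma decidable_const [computable]: "decidable (\<lambda>_. c)"
  unfolding decidable_def by (rule computable_const)

lemma decidable_eq0:
  assumes "computable f" shows "decidable (\<lambda>x. f x = (0::nat))"
proof -
  have "computable (\<lambda>x. 1 - f x)" by (intro computable assms)
  moreover have "1 - f x = of_bool (f x = 0)" for x by simp
  ultimately show ?thesis unfolding decidable_def by simp
qed

lemma decidable_not [computable]:
  assumes "decidable P" shows "decidable (\<lambda>x. \<not> P x)"
  using decidable_eq0[OF assms[unfolded decidable_def]] by simp

lemma decidable_conj [computable]: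
  assumes "decidable P" "decidable Q" shows "decidable (\<lambda>x. P x \<and> Q x)"
  using computable_times[OF assms[unfolded decidable_def]] unfolding decidable_def by (simp only: of_bool_conj)

lemma decidable_disj [computable]:
  assumes "decidable P" "decidable Q" shows "decidable (\<lambda>x. P x \<or> Q x)"
  using decidable_not[OF decidable_conj[OF decidable_not decidable_not, OF assms]] by simp

lemma decidable_imp [computable]:
  assumes "decidable P" "decidable Q" shows "decidable (\<lambda>x. P x \<longrightarrow> Q x)"
  using decidable_disj[OF decidable_not, OF assms] by (simp only: imp_conv_disj)

lemma decidable_le [computable]:
  fixes f g :: "_ \<Rightarrow> nat"
  assumes "computable f" "computable g" shows "decidable (\<lambda>x. f x \<le> g x)"
  using decidable_eq0[OF computable_minus[OF assms]] by simp

lemma decidable_less [computable]: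
  fixes f g :: "_ \<Rightarrow> nat"
  assumes "computable f" "computable g" shows "decidable (\<lambda>x. f x < g x)"
  using decidable_not[OF decidable_le[OF assms(2,1)]] by (simp add: not_le)

lemma decidable_eq [computable]:
  assumes "computable f" "computable g" shows "decidable (\<lambda>x. f x = g x)"
proof -
  have "decidable (\<lambda>x. code (f x) \<le> code (g x) \<and> code (g x) \<le> code (f x))"
    by (intro computable assms)
  then show ?thesis by (simp flip: eq_iff)
qed

text \<open>The branch for non-empty lists is also computed on the empty list, at the predecessor \<open>0\<close> of
  \<open>code [] = 0\<close>, and its value is then discarded.\<close>
lemma computable_case_list [computable]:
  assumes l: "computable l" and a: "computable a"
    and f: "computable (\<lambda>z. f (fst z) (fst (snd z)) (snd (snd z)))"
  shows "computable (\<lambda>x. case l x of [] \<Rightarrow> a x | y # ys \<Rightarrow> f x y ys)"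
proof -
  obtain hl where hl: "\<And>k g. rec_fun k g \<Longrightarrow> rec_fun k (\<lambda>xs. hl (g xs))" "\<And>x. code (l x) = hl (code x)"
    by (rule computableE[OF l]) iprover
  obtain ha where ha: "\<And>k g. rec_fun k g \<Longrightarrow> rec_fun k (\<lambda>xs. ha (g xs))" "\<And>x. code (a x) = ha (code x)"
    by (rule computableE[OF a]) iprover
  obtain hf where hf: "\<And>k g. rec_fun k g \<Longrightarrow> rec_fun k (\<lambda>xs. hf (g xs))"
    "\<And>z. code (f (fst z) (fst (snd z)) (snd (snd z))) = hf (code z)"
    by (rule computableE[OF f]) iprover
  have "code (case l x of [] \<Rightarrow> a x | y # ys \<Rightarrow> f x y ys) =
      (if hl (code x) = 0 then ha (code x) else hf (prod_encode (code x, hl (code x) - 1)))" for x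
    unfolding hl(2)[symmetric] using hf(2)[of "(x, hd (l x), tl (l x))"]
    by (cases "l x") (simp_all add: ha(2))
  moreover have "rec_fun (Suc 0) (\<lambda>xs. if hl (xs ! 0) = 0 then ha (xs ! 0)
      else hf (prod_encode (xs ! 0, hl (xs ! 0) - 1)))"
    by (intro hl(1) ha(1) hf(1) rec_fun_ifz rec_fun_prod_encode rec_fun_pred rec_fun_arg)
  ultimately show ?thesis by (rule computableI[rotated])
qed

lemma length_le_code: "length xs \<le> code xs"
proof (induction xs)
  case (Cons x xs)
  then show ?case using le_prod_encode_2[of "code xs" "code x"] by simp
qed simp

text \<open>A step moves one element from the remaining list into the accumulator and idles once the list is
  exhausted. The code of the list is at least its length and thus serves as the number of steps.\<close>
lemma computable_foldl [computable]:
  assumes g: "computable (\<lambda>z. g (fst z) (fst (snd z)) (snd (snd z)))" and b: "computable b" and l: "computable l"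
  shows "computable (\<lambda>x. foldl (g x) (b x) (l x))"
proof -
  let ?step = "\<lambda>x n st. case snd st of [] \<Rightarrow> st | y # ys \<Rightarrow> (g x (fst st) y, ys)"
  have step: "fst (rec_nat (b, l) (?step x) n) = foldl (g x) b (take n l) \<and>
      snd (rec_nat (b, l) (?step x) n) = drop n l" for x b l n
  proof (induction n)
    case (Suc n)
    show ?case
    proof (cases "n < length l")
      case True
      then have "drop n l = l ! n # drop (Suc n) l" by (simp add: Cons_nth_drop_Suc)
      with Suc True show ?thesis by (simp add: take_Suc_conv_app_nth)
    qed (use Suc in simp)
  qed simp
  have "fst (rec_nat (b x, l x) (?step x) (code (l x))) = foldl (g x) (b x) (l x)" for x
    using step[of "b x" "l x" x "code (l x)"] length_le_code[of "l x"] by simp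
  moreover have "computable (\<lambda>x. fst (rec_nat (b x, l x) (?step x) (code (l x))))"
    by (intro computable b l computable_comp[OF g, of "\<lambda>z. (fst (fst z), fst (snd (snd (fst z))), fst (snd z))", simplified])
  ultimately show ?thesis by simp
qed

lemma decidable_list_all [computable]:
  assumes P: "decidable (\<lambda>z. P (fst z) (snd z))" and l: "computable l"
  shows "decidable (\<lambda>x. \<forall>y\<in>set (l x). P x y)"
proof -
  have "foldl (\<lambda>b y. if P x y then b else 0) c l = (if \<forall>y\<in>set l. P x y then c else 0)" for x l and c :: nat
    by (induction l arbitrary: c) auto
  then have "foldl (\<lambda>b y. if P x y then b else 0) 1 (l x) = (of_bool (\<forall>y\<in>set (l x). P x y) :: nat)" for x
    by simp
  moreover have "computable (\<lambda>x. foldl (\<lambda>b y. if P x y then b else 0::nat) 1 (l x))"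
    by (intro computable l decidable_comp[OF P, of "\<lambda>z. (fst z, snd (snd z))", simplified])
  ultimately show ?thesis unfolding decidable_def by simp
qed

text \<open>A value may be computed by computing its code, which reduces integers to natural numbers.\<close>
lemma computable_of_code: "computable (\<lambda>x. code (F x)) \<Longrightarrow> computable F"
  unfolding computable_def by simp

lemma computable_div2:
  assumes "computable f" shows "computable (\<lambda>x. (f x :: nat) div 2)"
proof -
  have mod2: "rec_nat 0 (\<lambda>_ r. 1 - r) n = n mod 2" for n :: nat
    by (induction n) (auto simp: mod_Suc)
  have "rec_nat 0 (\<lambda>n r. r + rec_nat 0 (\<lambda>_ r. 1 - r) n) n = n div 2" for n :: nat
    unfolding mod2 by (induction n) (simp_all, presburger)
  moreover have "computable (\<lambda>x. rec_nat 0 (\<lambda>n r. r + rec_nat (0::nat) (\<lambda>_ r. 1 - r) n) (f x))"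
    by (intro computable assms)
  ultimately show ?thesis by simp
qed

lemma decidable_even:
  assumes "computable f" shows "decidable (\<lambda>x. even (f x :: nat))"
proof -
  have "decidable (\<lambda>x. 2 * (f x div 2) = f x)"
    by (intro computable computable_div2 assms)
  moreover have "2 * (n div 2) = n \<longleftrightarrow> even n" for n :: nat
    by (metis dvd_triv_left even_two_times_div_two)
  ultimately show ?thesis by simp
qed

text \<open>Non-negative integers \<open>n\<close> have the even code \<open>2 * n\<close>, and negative integers \<open>- n\<close> the odd code
  \<open>2 * n - 1\<close>.\<close>
lemma computable_nat [computable]:
  assumes "computable f" shows "computable (\<lambda>x. nat (f x))"
proof -
  have "nat i = (if even (code i) then code i div 2 else 0)" for i
    by (simp add: code_int_def int_encode_def sum_encode_def)
  moreover have "computable (\<lambda>x. if even (code (f x)) then code (f x) div 2 else 0)"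
    by (intro computable decidable_even computable_div2 assms)
  ultimately show ?thesis by simp
qed

lemma computable_nat_uminus [computable]:
  assumes "computable f" shows "computable (\<lambda>x. nat (- f x))"
proof -
  have "nat (- i) = (if even (code i) then 0 else Suc (code i div 2))" for i
    by (auto simp: code_int_def int_encode_def sum_encode_def)
  moreover have "computable (\<lambda>x. if even (code (f x)) then 0 else Suc (code (f x) div 2))"
    by (intro computable decidable_even computable_div2 assms)
  ultimately show ?thesis by simp
qed

lemma computable_int_diff:
  assumes "computable f" "computable g" shows "computable (\<lambda>x. int (f x) - int (g x))"
proof (rule computable_of_code)
  have "code (int a - int b) = (if b \<le> a then 2 * (a - b) else 2 * (b - a) - 1)" for a b
    by (auto simp: code_int_def int_encode_def sum_encode_def nat_diff_distrib)
  moreover have "computable (\<lambda>x. if g x \<le> f x then 2 * (f x - g x) else 2 * (g x - f x) - 1)"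
    by (intro computable assms)
  ultimately show "computable (\<lambda>x. code (int (f x) - int (g x)))" by simp
qed

text \<open>Addition and multiplication of integers reduce to operations on natural numbers by splitting the
  operands into positive and negative parts.\<close>
lemma computable_plus_int [computable]:
  fixes f g :: "_ \<Rightarrow> int"
  assumes "computable f" "computable g" shows "computable (\<lambda>x. f x + g x)"
proof -
  have eq: "i + j = int (nat i + nat j) - int (nat (- i) + nat (- j))" for i j
    by auto
  show ?thesis
    unfolding eq by (intro computable computable_int_diff assms)
qed

lemma computable_times_int [computable]:
  fixes f g :: "_ \<Rightarrow> int"
  assumes "computable f" "computable g" shows "computable (\<lambda>x. f x * g x)"
proof -
  have eq: "i * j = int (nat i * nat j + nat (- i) * nat (- j)) - int (nat i * nat (- j) + nat (- i) * nat j)" for i j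
  proof -
    have "i * j = (int (nat i) - int (nat (- i))) * (int (nat j) - int (nat (- j)))"
      by simp
    then show ?thesis by (simp only: of_nat_add of_nat_mult) (simp add: algebra_simps)
  qed
  show ?thesis
    unfolding eq by (intro computable computable_int_diff assms)
qed

lemma computable_power_int [computable]:
  fixes f :: "_ \<Rightarrow> int"
  assumes "computable f" "computable g" shows "computable (\<lambda>x. f x ^ g x)"
proof -
  have "rec_nat 1 (\<lambda>_ r. r * a) n = a ^ n" for a :: int and n by (induction n) auto
  moreover have "computable (\<lambda>x. rec_nat 1 (\<lambda>_ r. r * f x) (g x))"
    by (intro computable assms computable_comp[OF assms(1)])
  ultimately show ?thesis by simp
qed

lemma computable_length [computable]:
  assumes "computable l" shows "computable (\<lambda>x. length (l x))"
proof -
  have "foldl (\<lambda>n _. Suc n) n ys = n + length ys" for n and ys :: "'b list"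
    by (induction ys arbitrary: n) auto
  moreover have "computable (\<lambda>x. foldl (\<lambda>n _. Suc n) 0 (l x))"
    by (intro computable assms)
  ultimately show ?thesis by simp
qed

lemma decidable_list_ex [computable]:
  assumes "decidable (\<lambda>z. P (fst z) (snd z))" "computable l"
  shows "decidable (\<lambda>x. \<exists>y\<in>set (l x). P x y)"
  using decidable_not[OF decidable_list_all[OF decidable_not[OF assms(1)] assms(2)]] by simp

text \<open>Minimization over the code of the witness is defined exactly where a witness exists, since the
  tested property is decidable and every number codes a candidate.\<close>
lemma rec_enumerable_projection:
  fixes R :: "'a::codable \<Rightarrow> 'b::codable \<Rightarrow> bool"
  assumes "decidable (\<lambda>z. R (fst z) (snd z))"
  shows "rec_enumerable {code y | y. \<exists>x. R y x}"
proof -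
  obtain h where h: "\<And>k g. rec_fun k g \<Longrightarrow> rec_fun k (\<lambda>xs. h (g xs))"
    and h': "\<And>z. code (of_bool (R (fst z) (snd z)) :: nat) = h (code z)"
    by (rule computableE[OF assms[unfolded decidable_def]]) iprover
  have hR: "h (prod_encode (code y, code x)) = of_bool (R y x)" for y x
    using h'[of "(y, x)"] by simp
  have "rec_fun 2 (\<lambda>xs. 1 - h (prod_encode (xs ! 1, xs ! 0)))"
    by (intro rec_fun_minus rec_fun_const h rec_fun_prod_encode rec_fun_proj) auto
  then obtain r where "\<And>xs. length xs = 2 \<Longrightarrow> computes r xs (1 - h (prod_encode (xs ! 1, xs ! 0)))"
    unfolding rec_fun_def by blast
  from this[of "[_, _]"] have r: "computes r [w, n] (1 - h (prod_encode (n, w)))" for w n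
    by simp
  have "(\<exists>w. computes (Mu r) [n] w) \<longleftrightarrow> (\<exists>w. h (prod_encode (n, w)) \<noteq> 0)" for n
  proof
    assume "\<exists>w. computes (Mu r) [n] w"
    then obtain w where "computes r [w, n] 0" by (auto elim: computesE)
    then have "1 - h (prod_encode (n, w)) = 0" using r computes_deterministic by blast
    then have "h (prod_encode (n, w)) \<noteq> 0" by simp
    then show "\<exists>w. h (prod_encode (n, w)) \<noteq> 0" ..
  next
    assume ex: "\<exists>w. h (prod_encode (n, w)) \<noteq> 0"
    define w where "w = (LEAST w. h (prod_encode (n, w)) \<noteq> 0)"
    have w: "h (prod_encode (n, w)) \<noteq> 0"
      unfolding w_def using ex by (rule LeastI_ex)
    have "h (prod_encode (n, m)) = 0" if "m < w" for m
      using that not_less_Least unfolding w_def by blast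
    then have "computes r [m, n] 1" if "m < w" for m
      using r[of m n] that by simp
    moreover have "computes r [w, n] 0"
      using r[of w n] w by simp
    ultimately have "computes (Mu r) [n] w"
      by (intro computes.mu) (auto intro!: exI[of _ 1])
    then show "\<exists>w. computes (Mu r) [n] w" ..
  qed
  moreover have "(\<exists>w. h (prod_encode (n, w)) \<noteq> 0) \<longleftrightarrow> (\<exists>y. n = code y \<and> (\<exists>x. R y x))" for n
  proof -
    obtain y :: 'a where y: "n = code y" using bij_code by (metis bij_pointE)
    have "(\<exists>w. h (prod_encode (n, w)) \<noteq> 0) \<longleftrightarrow> (\<exists>x::'b. h (prod_encode (n, code x)) \<noteq> 0)"
      using bij_code[where 'a = 'b] by (metis bij_pointE)
    then show ?thesis by (auto simp: y hR)
  qed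
  ultimately have "{code y | y. \<exists>x. R y x} = {n. \<exists>w. computes (Mu r) [n] w}" by auto
  then show ?thesis unfolding rec_enumerable_def by blast
qed

section \<open>From formulas to systems\<close>

text \<open>A function of the variables \<open>x\<^sub>1, \<dots>, x\<^sub>q\<close> that is given by a formula with at most \<open>s\<close> nodes other
  than variables. The inequalities make the size an upper bound that may be rounded up. Working
  with functions avoids a syntax for formulas, as only their sizes matter.\<close>
inductive expressible :: "nat \<Rightarrow> nat \<Rightarrow> ((nat \<Rightarrow> int) \<Rightarrow> int) \<Rightarrow> bool" for q where
  var: "i \<in> {1..q} \<Longrightarrow> expressible q s (\<lambda>x. x i)"
| one: "1 \<le> s \<Longrightarrow> expressible q s (\<lambda>_. 1)"
| add: "expressible q s f \<Longrightarrow> expressible q t g \<Longrightarrow> s + t + 1 \<le> u \<Longrightarrow> expressible q u (\<lambda>x. f x + g x)"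
| diff: "expressible q s f \<Longrightarrow> expressible q t g \<Longrightarrow> s + t + 1 \<le> u \<Longrightarrow> expressible q u (\<lambda>x. f x - g x)"
| mult: "expressible q s f \<Longrightarrow> expressible q t g \<Longrightarrow> s + t + 1 \<le> u \<Longrightarrow> expressible q u (\<lambda>x. f x * g x)"

lemma expressible_cong:
  assumes "expressible q s f" "\<And>i. i \<in> {1..q} \<Longrightarrow> x i = y i"
  shows "f x = f y"
  using assms by (induction rule: expressible.induct) auto

abbreviation solves :: "(nat \<Rightarrow> int) \<Rightarrow> equation set \<Rightarrow> bool" where
  "solves x S \<equiv> \<forall>e\<in>S. satisfies x e"

lemma solves_cong:
  assumes "S \<subseteq> E n" "\<And>i. i \<in> {1..n} \<Longrightarrow> x i = y i"
  shows "solves x S \<longleftrightarrow> solves y S"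
proof -
  have "satisfies x e \<longleftrightarrow> satisfies y e" if "e \<in> S" for e
    using assms that unfolding E_def by fastforce
  then show ?thesis by blast
qed

lemma E_mono: "n \<le> m \<Longrightarrow> E n \<subseteq> E m"
  unfolding E_def by fastforce

text \<open>A system that acts as a computation of \<open>f\<close> from the first \<open>n\<close> variables, with result \<open>x\<^sub>k\<close>. Since
  extensions exist and are unique, its solutions correspond one-to-one to the assignments to the
  first \<open>n\<close> variables, and so infinity can be transferred between both.\<close>
definition defines_value ::
    "nat \<Rightarrow> nat \<Rightarrow> equation set \<Rightarrow> nat \<Rightarrow> ((nat \<Rightarrow> int) \<Rightarrow> int) \<Rightarrow> bool" where
  "defines_value n m S k f \<longleftrightarrow> n \<le> m \<and> S \<subseteq> E m \<and> k \<in> {1..m} \<and>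
     (\<forall>x. solves x S \<longrightarrow> x k = f x) \<and>
     (\<forall>x. \<exists>y. (\<forall>i\<in>{1..n}. y i = x i) \<and> solves y S) \<and>
     (\<forall>x y. solves x S \<longrightarrow> solves y S \<longrightarrow> (\<forall>i\<in>{1..n}. x i = y i) \<longrightarrow> (\<forall>i\<in>{1..m}. x i = y i))"

lemma defines_valueD:
  assumes "defines_value n m S k f"
  shows "n \<le> m" "S \<subseteq> E m" "k \<in> {1..m}" "solves x S \<Longrightarrow> x k = f x"
    "solves x S \<Longrightarrow> solves y S \<Longrightarrow> \<forall>i\<in>{1..n}. x i = y i \<Longrightarrow> \<forall>i\<in>{1..m}. x i = y i"
  using assms unfolding defines_value_def by blast+

lemma defines_value_extend:
  assumes "defines_value n m S k f"
  obtains y where "\<forall>i\<in>{1..n}. y i = x i" "solves y S"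
  using assms unfolding defines_value_def by blast

text \<open>The second system is built on top of the first, with fresh variables above \<open>m\<close>. The result of the
  operation is the new variable with index \<open>l + 1\<close>, which the equation \<open>e\<close> determines.\<close>
lemma defines_value_binop:
  assumes f: "defines_value n m S k f" and g: "defines_value m l T k' g"
    and e: "\<And>x. satisfies x e \<longleftrightarrow> x (Suc l) = op (x k) (x k')" and eE: "e \<in> E (Suc l)"
  shows "defines_value n (Suc l) (insert e (S \<union> T)) (Suc l) (\<lambda>x. op (f x) (g x))"
  unfolding defines_value_def
proof (intro conjI allI impI ballI)
  have nm: "n \<le> m" "m \<le> l" and SE: "S \<subseteq> E m" and TE: "T \<subseteq> E l" and k: "k \<in> {1..m}" "k' \<in> {1..l}"
    using defines_valueD(1-3)[OF f] defines_valueD(1-3)[OF g] by auto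
  show "n \<le> Suc l" using nm by simp
  have Tl: "S \<union> T \<subseteq> E l" using SE TE E_mono[of m l] nm by auto
  then show "insert e (S \<union> T) \<subseteq> E (Suc l)" using eE E_mono[of l "Suc l"] by auto
  show "Suc l \<in> {1..Suc l}" by simp
  show "x (Suc l) = op (f x) (g x)" if "solves x (insert e (S \<union> T))" for x
    using that defines_valueD(4)[OF f, of x] defines_valueD(4)[OF g, of x] e by auto
  show "\<exists>y. (\<forall>i\<in>{1..n}. y i = x i) \<and> solves y (insert e (S \<union> T))" for x
  proof -
    obtain y where y: "\<forall>i\<in>{1..n}. y i = x i" "solves y S" by (rule defines_value_extend[OF f])
    obtain z where z: "\<forall>i\<in>{1..m}. z i = y i" "solves z T" by (rule defines_value_extend[OF g])
    let ?w = "z(Suc l := op (z k) (z k'))"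
    have "solves z S" using solves_cong[OF SE, of z y] z(1) y(2) by simp
    then have "solves z (S \<union> T)" using z(2) by auto
    then have "solves ?w (S \<union> T)" using solves_cong[OF Tl, of z ?w] by auto
    moreover have "satisfies ?w e" using k nm by (auto simp: e)
    moreover have "\<forall>i\<in>{1..n}. ?w i = x i" using nm y z by auto
    ultimately show ?thesis by (intro exI[of _ ?w]) auto
  qed
  show "x i = y i"
    if xy: "solves x (insert e (S \<union> T))" "solves y (insert e (S \<union> T))" "\<forall>i\<in>{1..n}. x i = y i"
      and i: "i \<in> {1..Suc l}" for x y i
  proof -
    have sxy: "solves x S" "solves y S" "solves x T" "solves y T" using xy by auto
    have "\<forall>i\<in>{1..m}. x i = y i" using defines_valueD(5)[OF f] sxy xy(3) by blast
    then have l: "\<forall>i\<in>{1..l}. x i = y i" using defines_valueD(5)[OF g] sxy by blast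
    moreover have "k \<in> {1..l}" "k' \<in> {1..l}" using k nm by auto
    then have "x (Suc l) = y (Suc l)" using e[of x] e[of y] xy l by auto
    ultimately show ?thesis using i by (auto simp: le_Suc_eq)
  qed
qed

text \<open>Each node of the formula that is not a variable receives one new variable. The number \<open>n\<close> of
  variables already in use is arbitrary, because the second argument of an operation is compiled
  after the first.\<close>
lemma expressible_defines_value:
  assumes "expressible q s f" "q \<le> n"
  shows "\<exists>m S k. m \<le> n + s \<and> defines_value n m S k f"
  using assms
proof (induction arbitrary: n rule: expressible.induct)
  case (var i s)
  then have "defines_value n n {} i (\<lambda>x. x i)" by (auto simp: defines_value_def)
  then show ?case using le_add1 by blast
next
  case (one s)
  have "defines_value n (Suc n) {One (Suc n)} (Suc n) (\<lambda>_. 1)"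
    unfolding defines_value_def
  proof (intro conjI allI impI ballI)
    show "\<exists>y. (\<forall>i\<in>{1..n}. y i = x i) \<and> solves y {One (Suc n)}" for x
      by (rule exI[of _ "x(Suc n := 1)"]) auto
  qed (auto simp: E_def le_Suc_eq)
  then show ?case using one by (metis add_le_mono1 add.commute le_refl plus_1_eq_Suc)
next
  case (add s f t g u)
  obtain m S k where f: "m \<le> n + s" "defines_value n m S k f" using add.IH(1) add.prems by blast
  then have "q \<le> m" using add.prems by (simp add: defines_value_def)
  then obtain l T k' where g: "l \<le> m + t" "defines_value m l T k' g"
    using add.IH(2)[of m] by blast
  have "Add k k' (Suc l) \<in> E (Suc l)"
    using f(2) g(2) by (auto simp: E_def defines_value_def)
  from defines_value_binop[OF f(2) g(2) _ this, of "(+)"]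
  have "defines_value n (Suc l) (insert (Add k k' (Suc l)) (S \<union> T)) (Suc l) (\<lambda>x. f x + g x)"
    by (simp add: eq_commute)
  moreover have "Suc l \<le> n + u" using f(1) g(1) add.hyps(3) by simp
  ultimately show ?case by blast
next
  case (diff s f t g u)
  obtain m S k where f: "m \<le> n + s" "defines_value n m S k f" using diff.IH(1) diff.prems by blast
  then have "q \<le> m" using diff.prems by (simp add: defines_value_def)
  then obtain l T k' where g: "l \<le> m + t" "defines_value m l T k' g"
    using diff.IH(2)[of m] by blast
  have "Add (Suc l) k' k \<in> E (Suc l)"
    using f(2) g(2) by (auto simp: E_def defines_value_def)
  from defines_value_binop[OF f(2) g(2) _ this, of "(-)"]
  have "defines_value n (Suc l) (insert (Add (Suc l) k' k) (S \<union> T)) (Suc l) (\<lambda>x. f x - g x)"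
    by (simp add: eq_diff_eq)
  moreover have "Suc l \<le> n + u" using f(1) g(1) diff.hyps(3) by simp
  ultimately show ?case by blast
next
  case (mult s f t g u)
  obtain m S k where f: "m \<le> n + s" "defines_value n m S k f" using mult.IH(1) mult.prems by blast
  then have "q \<le> m" using mult.prems by (simp add: defines_value_def)
  then obtain l T k' where g: "l \<le> m + t" "defines_value m l T k' g"
    using mult.IH(2)[of m] by blast
  have "Mult k k' (Suc l) \<in> E (Suc l)"
    using f(2) g(2) by (auto simp: E_def defines_value_def)
  from defines_value_binop[OF f(2) g(2) _ this, of "(*)"]
  have "defines_value n (Suc l) (insert (Mult k k' (Suc l)) (S \<union> T)) (Suc l) (\<lambda>x. f x * g x)"
    by (simp add: eq_commute)
  moreover have "Suc l \<le> n + u" using f(1) g(1) mult.hyps(3) by simp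
  ultimately show ?case by blast
qed

text \<open>The equation \<open>x\<^sub>k + x\<^sub>k = x\<^sub>k\<close> forces the computed value to be zero. Solutions of the resulting
  system are determined by their first \<open>q\<close> entries, so infinitely many of them restrict to infinitely
  many zeros of \<open>f\<close>.\<close>
theorem large_zero_imp_infinite:
  assumes T: Conjecture_T and f: "expressible q s f" and x: "f x = 0"
    and i: "i \<in> {1..q}" and large: "\<bar>x i\<bar> > 2 ^ (2 ^ (q + s))"
  shows "infinite {x \<in> {1..q} \<rightarrow>\<^sub>E UNIV. f x = 0}"
proof -
  obtain m S k where m: "m \<le> q + s" and dv: "defines_value q m S k f"
    using expressible_defines_value[OF f order_refl] by blast
  note dvD = defines_valueD[OF dv]
  let ?S = "insert (Add k k k) S"
  have SE: "?S \<subseteq> E m" using dvD(2,3) by (auto simp: E_def)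
  have m1: "1 \<le> m" using dvD(1) i by auto
  obtain y where y: "\<forall>i\<in>{1..q}. y i = x i" "solves y S" by (rule defines_value_extend[OF dv])
  have "f y = 0" using expressible_cong[OF f, of y x] y(1) x by simp
  then have "solves y ?S" using y(2) dvD(4)[of y] by auto
  let ?y = "restrict y {1..m}"
  have "solves ?y ?S" using solves_cong[OF SE, of ?y y] \<open>solves y ?S\<close> by simp
  then have sol: "?y \<in> solutions m ?S" by (simp add: solutions_def)
  have im: "i \<in> {1..m}" using i dvD(1) by auto
  have "(2::int) ^ (2 ^ (m - 1)) \<le> 2 ^ (2 ^ (q + s))"
    by (intro power_increasing) (use m in auto)
  also have "\<dots> < \<bar>?y i\<bar>" using large y(1) i im by simp
  finally have "\<not> \<bar>?y i\<bar> \<le> 2 ^ (2 ^ (m - 1))" by simp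
  then have inf: "infinite (solutions m ?S)"
    using T sol SE m1 im unfolding Conjecture_T_def by meson
  have "inj_on (\<lambda>z. restrict z {1..q}) (solutions m ?S)"
  proof (rule inj_onI)
    fix z w assume z: "z \<in> solutions m ?S" and w: "w \<in> solutions m ?S"
      and eq: "restrict z {1..q} = restrict w {1..q}"
    have "\<forall>i\<in>{1..q}. z i = w i" using eq by (metis restrict_apply')
    moreover have "solves z S" "solves w S" using z w by (auto simp: solutions_def)
    ultimately have "\<forall>i\<in>{1..m}. z i = w i" using dvD(5) by blast
    then show "z = w" using z w by (intro PiE_ext[of z "{1..m}" "\<lambda>_. UNIV"]) (auto simp: solutions_def)
  qed
  moreover have "(\<lambda>z. restrict z {1..q}) ` solutions m ?S \<subseteq> {x \<in> {1..q} \<rightarrow>\<^sub>E UNIV. f x = 0}"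
  proof clarify
    fix z assume z: "z \<in> solutions m ?S"
    then have "z k + z k = z k" "z k = f z" using dvD(4)[of z] by (auto simp: solutions_def)
    then have "f z = 0" by simp
    then show "restrict z {1..q} \<in> {1..q} \<rightarrow>\<^sub>E UNIV \<and> f (restrict z {1..q}) = 0"
      using expressible_cong[OF f, of "restrict z {1..q}" z] by simp
  qed
  ultimately show ?thesis using inf by (meson finite_imageD finite_subset)
qed

section \<open>Sizes of formulas\<close>

lemma expressible_mono:
  assumes "expressible q s f" "s \<le> t" shows "expressible q t f"
  using assms by cases (auto intro: expressible.intros)

text \<open>Zero is available as \<open>1 - 1\<close>.\<close>
lemma expressible_0: "3 \<le> s \<Longrightarrow> expressible q s (\<lambda>_. 0)"
  using diff[OF one one, of 1 1 s q] by simp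

lemma expressible_of_nat: "2 * n + 3 \<le> s \<Longrightarrow> expressible q s (\<lambda>_. int n)"
proof (induction n arbitrary: s)
  case (Suc n)
  then have "expressible q s (\<lambda>x. int n + 1)"
    by (intro add[where s = "2 * n + 3" and t = 1] one) auto
  then show ?case by (simp add: add.commute)
qed (simp add: expressible_0)

lemma expressible_const:
  assumes "2 * nat \<bar>a\<bar> + 7 \<le> s" shows "expressible q s (\<lambda>_. a)"
proof (cases "a \<ge> 0")
  case True
  then show ?thesis using expressible_of_nat[of "nat a" s q] assms by simp
next
  case False
  then show ?thesis
    using diff[OF expressible_0 expressible_of_nat, of 3 "nat \<bar>a\<bar>" "2 * nat \<bar>a\<bar> + 3" s q] assms by simp
qed

lemma expressible_power:
  assumes "expressible q s f" shows "expressible q (1 + e * (s + 1)) (\<lambda>x. f x ^ e)"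
proof (induction e)
  case (Suc e)
  show ?case using mult[OF assms Suc, of "1 + Suc e * (s + 1)"] by simp
qed (simp add: one)

lemma expressible_prod:
  assumes "finite I" "\<And>i. i \<in> I \<Longrightarrow> expressible q s (f i)"
  shows "expressible q (1 + card I * (s + 1)) (\<lambda>x. \<Prod>i\<in>I. f i x)"
  using assms
proof (induction I)
  case (insert i I)
  then have "expressible q s (f i)" "expressible q (1 + card I * (s + 1)) (\<lambda>x. \<Prod>i\<in>I. f i x)" by auto
  from mult[OF this, of "1 + card (insert i I) * (s + 1)"] insert.hyps show ?case by simp
qed (simp add: one)

lemma expressible_sum:
  assumes "finite I" "\<And>i. i \<in> I \<Longrightarrow> expressible q s (f i)"
  shows "expressible q (3 + card I * (s + 1)) (\<lambda>x. \<Sum>i\<in>I. f i x)"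
  using assms
proof (induction I)
  case (insert i I)
  then have "expressible q s (f i)" "expressible q (3 + card I * (s + 1)) (\<lambda>x. \<Sum>i\<in>I. f i x)" by auto
  from add[OF this, of "3 + card (insert i I) * (s + 1)"] insert.hyps show ?case by simp
qed (simp add: expressible_0)

section \<open>The four-square theorem\<close>

definition four_squares :: "int \<Rightarrow> bool" where
  "four_squares n \<longleftrightarrow> (\<exists>a b c d. n = a\<^sup>2 + b\<^sup>2 + c\<^sup>2 + d\<^sup>2)"

text \<open>Multiplicativity of the norm of quaternions, with one factor conjugated: if both quadruples agree
  modulo \<open>m\<close>, then the last three components on the right vanish modulo \<open>m\<close>, as the descent requires.\<close>
lemma euler_four_square_identity:
  fixes a b c d :: "'a::comm_ring_1"
  shows "(a\<^sup>2 + b\<^sup>2 + c\<^sup>2 + d\<^sup>2) * (x\<^sup>2 + y\<^sup>2 + z\<^sup>2 + w\<^sup>2) =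
    (a * x + b * y + c * z + d * w)\<^sup>2 + (a * y - b * x + c * w - d * z)\<^sup>2 +
    (a * z - c * x + d * y - b * w)\<^sup>2 + (a * w - d * x + b * z - c * y)\<^sup>2"
  by (simp add: power2_eq_square algebra_simps)

lemma four_squares_mult: "four_squares m \<Longrightarrow> four_squares n \<Longrightarrow> four_squares (m * n)"
  unfolding four_squares_def by (metis euler_four_square_identity)

lemma centered_residue:
  fixes x m :: int
  assumes "m > 0"
  obtains y k where "x = y + m * k" "2 * \<bar>y\<bar> \<le> m"
proof -
  define y where "y = (x + m div 2) mod m - m div 2"
  have "(x + m div 2) mod m \<in> {0..<m}" using assms by simp
  moreover have "m - 1 \<le> 2 * (m div 2)" "2 * (m div 2) \<le> m" by presburger+
  ultimately have "2 * y \<le> m" "- m \<le> 2 * y" unfolding y_def by simp_all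
  then have "2 * \<bar>y\<bar> \<le> m" by simp
  moreover have "x = y + m * ((x + m div 2) div m)"
    unfolding y_def using mult_div_mod_eq[of m "x + m div 2"] by linarith
  ultimately show ?thesis using that by blast
qed

text \<open>Pigeonhole principle: with \<open>h = (p - 1) / 2\<close>, the squares of \<open>0, \<dots>, h\<close> are distinct modulo \<open>p\<close>, and
  so are the numbers \<open>- 1 - y\<^sup>2\<close>. These are \<open>2 * (h + 1) > p\<close> residues altogether, so
  one residue occurs in both families.\<close>
lemma odd_prime_dvd_sum_two_squares_plus_1:
  fixes p :: int
  assumes p: "prime p" "odd p"
  obtains x y where "p dvd x\<^sup>2 + y\<^sup>2 + 1" "0 \<le> x" "0 \<le> y" "2 * x < p" "2 * y < p"
proof -
  define h where "h = p div 2"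
  have p2: "p = 2 * h + 1" using p unfolding h_def by presburger
  have p1: "p > 1" using p prime_gt_1_int by blast
  have inj0: "x = y" if "p dvd x\<^sup>2 - y\<^sup>2" "x \<in> {0..h}" "y \<in> {0..h}" for x y
  proof -
    have "p dvd (x - y) * (x + y)" using that by (simp add: power2_eq_square algebra_simps)
    then have "p dvd x - y \<or> p dvd x + y" using p(1) by (simp add: prime_dvd_mult_iff)
    then show ?thesis
    proof
      assume "p dvd x - y"
      then show ?thesis using that p2 zdvd_not_zless[of "\<bar>x - y\<bar>" p] by fastforce
    next
      assume "p dvd x + y"
      then show ?thesis using that p2 zdvd_not_zless[of "x + y" p] by fastforce
    qed
  qed
  let ?f = "\<lambda>x. x\<^sup>2 mod p" and ?g = "\<lambda>y. (- 1 - y\<^sup>2) mod p"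
  have f: "inj_on ?f {0..h}" by (rule inj_onI) (auto simp: mod_eq_dvd_iff intro: inj0)
  have g: "inj_on ?g {0..h}"
  proof (rule inj_onI)
    fix x y assume xy: "x \<in> {0..h}" "y \<in> {0..h}" "?g x = ?g y"
    then have "p dvd y\<^sup>2 - x\<^sup>2" by (simp add: mod_eq_dvd_iff)
    then show "x = y" using inj0[of y x] xy by simp
  qed
  have "?f ` {0..h} \<inter> ?g ` {0..h} \<noteq> {}"
  proof
    assume disj: "?f ` {0..h} \<inter> ?g ` {0..h} = {}"
    have "card (?f ` {0..h} \<union> ?g ` {0..h}) = nat (h + 1) + nat (h + 1)"
      using card_Un_disjoint[OF _ _ disj] card_image[OF f] card_image[OF g] by simp
    moreover have "card (?f ` {0..h} \<union> ?g ` {0..h}) \<le> card {0..<p}"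
      using p1 by (intro card_mono) auto
    ultimately show False using p2 p1 by simp
  qed
  then obtain x y where xy: "x \<in> {0..h}" "y \<in> {0..h}" "x\<^sup>2 mod p = (- 1 - y\<^sup>2) mod p"
    by blast
  then have "p dvd x\<^sup>2 - (- 1 - y\<^sup>2)" by (simp only: mod_eq_dvd_iff)
  then have "p dvd x\<^sup>2 + y\<^sup>2 + 1" by (simp add: algebra_simps)
  then show ?thesis using that xy p2 by auto
qed

text \<open>Replace \<open>a, b, c, d\<close> by their residues \<open>x, y, z, w\<close> of least absolute value modulo \<open>m\<close>. The sum of their
  squares is \<open>m * r\<close> with \<open>0 \<le> r \<le> m\<close>. In the product of both sums of squares, Euler's identity
  produces four squares of multiples of \<open>m\<close>, and dividing by \<open>m\<^sup>2\<close> leaves \<open>r * p\<close>. The extreme cases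
  \<open>r = 0\<close> and \<open>r = m\<close> are excluded because in both of them \<open>m\<close> would divide \<open>p\<close>: the residues are all \<open>0\<close> or
  all \<open>\<plusminus> m / 2\<close>.\<close>
lemma four_squares_descent:
  fixes p m :: int
  assumes p: "prime p" and m: "1 < m" "m < p" and mp: "four_squares (m * p)"
  shows "\<exists>r. 0 < r \<and> r < m \<and> four_squares (r * p)"
proof -
  obtain a b c d where abcd: "m * p = a\<^sup>2 + b\<^sup>2 + c\<^sup>2 + d\<^sup>2"
    using mp unfolding four_squares_def by blast
  have m0: "m > 0" using m by simp
  obtain x i where x: "a = x + m * i" "2 * \<bar>x\<bar> \<le> m" by (rule centered_residue[OF m0])
  obtain y j where y: "b = y + m * j" "2 * \<bar>y\<bar> \<le> m" by (rule centered_residue[OF m0])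
  obtain z k where z: "c = z + m * k" "2 * \<bar>z\<bar> \<le> m" by (rule centered_residue[OF m0])
  obtain w l where w: "d = w + m * l" "2 * \<bar>w\<bar> \<le> m" by (rule centered_residue[OF m0])
  \<comment> \<open>The quotient \<open>(x\<^sup>2 + y\<^sup>2 + z\<^sup>2 + w\<^sup>2) / m\<close>, computed from \<open>x = a - m * i\<close> etc. without division.\<close>
  define r where "r = p - (2 * (i * x + j * y + k * z + l * w) + m * (i\<^sup>2 + j\<^sup>2 + k\<^sup>2 + l\<^sup>2))"
  have mr: "m * r = x\<^sup>2 + y\<^sup>2 + z\<^sup>2 + w\<^sup>2"
    unfolding r_def right_diff_distrib abcd x(1) y(1) z(1) w(1)
    by (simp add: power2_eq_square algebra_simps)
  have sq: "4 * t\<^sup>2 \<le> m\<^sup>2" if "2 * \<bar>t\<bar> \<le> m" for t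
    using power_mono[OF that, of 2] by (simp add: power_mult_distrib)
  have "4 * (m * r) \<le> 4 * m\<^sup>2"
    unfolding mr using sq[OF x(2)] sq[OF y(2)] sq[OF z(2)] sq[OF w(2)] by simp
  then have "r \<le> m" using m0 by (simp add: power2_eq_square)
  have "0 \<le> m * r" unfolding mr by simp
  then have "0 \<le> r" using m0 by (simp add: zero_le_mult_iff)
  have ndvd: "\<not> m dvd p"
    using m p by (metis prime_int_iff zdvd_not_zless not_less order.strict_iff_order zero_less_one less_trans)
  have "r \<noteq> 0"
  proof
    assume "r = 0"
    then have "x = 0 \<and> y = 0 \<and> z = 0 \<and> w = 0"
      using mr by (simp add: add_nonneg_eq_0_iff)
    then have "p = m * (i\<^sup>2 + j\<^sup>2 + k\<^sup>2 + l\<^sup>2)"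
      using \<open>r = 0\<close> unfolding r_def by simp
    then show False using ndvd by simp
  qed
  moreover have "r \<noteq> m"
  proof
    assume "r = m"
    then have "4 * x\<^sup>2 + 4 * y\<^sup>2 + 4 * z\<^sup>2 + 4 * w\<^sup>2 = 4 * m\<^sup>2"
      using mr by (simp add: power2_eq_square)
    then have "4 * x\<^sup>2 = m\<^sup>2" "4 * y\<^sup>2 = m\<^sup>2" "4 * z\<^sup>2 = m\<^sup>2" "4 * w\<^sup>2 = m\<^sup>2"
      using sq[OF x(2)] sq[OF y(2)] sq[OF z(2)] sq[OF w(2)] by linarith+
    then have "(2 * x)\<^sup>2 = m\<^sup>2" "(2 * y)\<^sup>2 = m\<^sup>2" "(2 * z)\<^sup>2 = m\<^sup>2" "(2 * w)\<^sup>2 = m\<^sup>2"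
      by (simp_all add: power_mult_distrib)
    moreover have "m dvd t" if "t\<^sup>2 = m\<^sup>2" for t
      using that by (auto simp: power2_eq_iff)
    ultimately have "m dvd 2 * x" "m dvd 2 * y" "m dvd 2 * z" "m dvd 2 * w"
      by blast+
    then have "m dvd i * (2 * x) + j * (2 * y) + k * (2 * z) + l * (2 * w)"
      by (simp only: dvd_add dvd_mult)
    moreover have "p = m + (i * (2 * x) + j * (2 * y) + k * (2 * z) + l * (2 * w)) + m * (i\<^sup>2 + j\<^sup>2 + k\<^sup>2 + l\<^sup>2)"
      using \<open>r = m\<close> unfolding r_def by (simp add: algebra_simps)
    ultimately show False using ndvd by (metis dvd_add dvd_refl dvd_triv_left)
  qed
  moreover have "four_squares (r * p)"
  proof -
    have "m\<^sup>2 * (r * p) = (a\<^sup>2 + b\<^sup>2 + c\<^sup>2 + d\<^sup>2) * (x\<^sup>2 + y\<^sup>2 + z\<^sup>2 + w\<^sup>2)"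
      unfolding abcd[symmetric] mr[symmetric] by (simp add: power2_eq_square)
    also have "\<dots> = (a * x + b * y + c * z + d * w)\<^sup>2 + (a * y - b * x + c * w - d * z)\<^sup>2 +
        (a * z - c * x + d * y - b * w)\<^sup>2 + (a * w - d * x + b * z - c * y)\<^sup>2"
      by (rule euler_four_square_identity)
    also have "a * x + b * y + c * z + d * w = m * (r + i * x + j * y + k * z + l * w)"
      unfolding distrib_left mr x(1) y(1) z(1) w(1) by (simp add: power2_eq_square algebra_simps)
    also have "a * y - b * x + c * w - d * z = m * (i * y - j * x + k * w - l * z)"
      unfolding x(1) y(1) z(1) w(1) by (simp add: algebra_simps)
    also have "a * z - c * x + d * y - b * w = m * (i * z - k * x + l * y - j * w)"
      unfolding x(1) y(1) z(1) w(1) by (simp add: algebra_simps)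
    also have "a * w - d * x + b * z - c * y = m * (i * w - l * x + j * z - k * y)"
      unfolding x(1) y(1) z(1) w(1) by (simp add: algebra_simps)
    finally have "r * p = (r + i * x + j * y + k * z + l * w)\<^sup>2 + (i * y - j * x + k * w - l * z)\<^sup>2 +
        (i * z - k * x + l * y - j * w)\<^sup>2 + (i * w - l * x + j * z - k * y)\<^sup>2"
      using m0 by (simp add: power_mult_distrib flip: distrib_left)
    then show ?thesis unfolding four_squares_def by blast
  qed
  ultimately show ?thesis using \<open>0 \<le> r\<close> \<open>r \<le> m\<close> by (intro exI[of _ r]) simp
qed

text \<open>The multiple of \<open>p\<close> provided by the pigeonhole principle is below \<open>p\<^sup>2\<close>, which is where the descent
  starts. It ends at \<open>p\<close> itself.\<close>
lemma four_squares_prime: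
  fixes p :: int
  assumes p: "prime p" shows "four_squares p"
proof (cases "odd p")
  case False
  then have "p = 2" using p primes_dvd_imp_eq two_is_prime by blast
  then have "p = 1\<^sup>2 + 1\<^sup>2 + 0\<^sup>2 + 0\<^sup>2" by simp
  then show ?thesis unfolding four_squares_def by blast
next
  case True
  have descent: "four_squares (int m * p) \<Longrightarrow> 0 < m \<Longrightarrow> int m < p \<Longrightarrow> four_squares p" for m
  proof (induction m rule: less_induct)
    case (less m)
    show ?case
    proof (cases "m = 1")
      case False
      then obtain r where r: "0 < r" "r < int m" "four_squares (r * p)"
        using four_squares_descent[OF p, of "int m"] less.prems by auto
      then show ?thesis using less.IH[of "nat r"] less.prems by auto
    qed (use less.prems in simp)
  qed
  obtain x y where xy: "p dvd x\<^sup>2 + y\<^sup>2 + 1" "0 \<le> x" "0 \<le> y" "2 * x < p" "2 * y < p"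
    using odd_prime_dvd_sum_two_squares_plus_1[OF p True] by blast
  then obtain m where m: "x\<^sup>2 + y\<^sup>2 + 1 = p * m" by blast
  have p1: "p > 1" using p prime_gt_1_int by blast
  have "0 < p * m" unfolding m[symmetric] by (simp add: add_nonneg_pos)
  then have "0 < m" using p1 by (simp add: zero_less_mult_iff)
  have "(2 * x)\<^sup>2 < p\<^sup>2" "(2 * y)\<^sup>2 < p\<^sup>2" using xy by (intro power_strict_mono; simp)+
  moreover have "p\<^sup>2 \<ge> 2 * 2" unfolding power2_eq_square using p1 by (intro mult_mono) auto
  ultimately have "4 * (p * m) < 4 * p\<^sup>2" unfolding m[symmetric] by (simp add: power_mult_distrib)
  then have "m < p" using p1 by (simp add: power2_eq_square)
  have "m * p = x\<^sup>2 + y\<^sup>2 + 1\<^sup>2 + 0\<^sup>2" using m by (simp add: mult.commute)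
  then have "four_squares (m * p)" unfolding four_squares_def by blast
  then have "four_squares (int (nat m) * p)" using \<open>0 < m\<close> by simp
  then show ?thesis using descent[of "nat m"] \<open>0 < m\<close> \<open>m < p\<close> by simp
qed

theorem lagrange_four_squares: "four_squares (int n)"
proof (induction n rule: prime_divisors_induct)
  case zero
  have "int 0 = 0\<^sup>2 + 0\<^sup>2 + 0\<^sup>2 + 0\<^sup>2" by simp
  then show ?case unfolding four_squares_def by blast
next
  case (unit n)
  then have "int n = 1\<^sup>2 + 0\<^sup>2 + 0\<^sup>2 + 0\<^sup>2" by simp
  then show ?case unfolding four_squares_def by blast
next
  case (factor p n)
  then show ?case by (simp add: four_squares_mult four_squares_prime)
qed

section \<open>The size of a polynomial in terms of its code\<close>

definition exponents :: "nat \<Rightarrow> (nat \<Rightarrow>\<^sub>0 nat) \<Rightarrow> nat list" where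
  "exponents p m = map (lookup m) [1..<Suc p]"

lemma nth_exponents: "i < p \<Longrightarrow> exponents p m ! i = lookup m (Suc i)"
  by (simp add: exponents_def del: upt_Suc)

lemma length_exponents: "length (exponents p m) = p"
  by (simp add: exponents_def)

lemma inj_on_exponents: "inj_on (exponents p) {m. keys m \<subseteq> {1..p}}"
proof (rule inj_onI)
  fix m m' assume m: "m \<in> {m. keys m \<subseteq> {1..p}}" "m' \<in> {m. keys m \<subseteq> {1..p}}"
    and eq: "exponents p m = exponents p m'"
  have "lookup m i = lookup m' i" for i
  proof (cases "i \<in> {1..p}")
    case True
    then show ?thesis
      using nth_exponents[of "i - 1" p m] nth_exponents[of "i - 1" p m'] eq by auto
  next
    case False
    then have "i \<notin> keys m" "i \<notin> keys m'" using m by auto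
    then show ?thesis by (simp add: in_keys_iff)
  qed
  then show "m = m'" by (rule poly_mapping_eqI)
qed

lemma term_code_exponents:
  "term_code p D m = prod_encode (list_encode (exponents p m), int_encode (lookup D m))"
  by (simp add: term_code_def exponents_def)

lemma inj_on_term_code:
  assumes "D \<in> polys p" shows "inj_on (term_code p D) (keys D)"
  using inj_on_exponents[of p] assms unfolding inj_on_def polys_def
  by (auto simp: term_code_exponents list_encode_eq)

text \<open>All numerical data of a polynomial are bounded by its code, because the codings of pairs and lists
  dominate their components.\<close>
lemma member_less_list_encode: "x \<in> set xs \<Longrightarrow> x < list_encode xs"
proof (induction xs)
  case (Cons y ys)
  then show ?case
    using le_prod_encode_1[of y "list_encode ys"] le_prod_encode_2[of "list_encode ys" y] by auto
qed simp

lemma abs_le_int_encode: "nat \<bar>a\<bar> \<le> int_encode a"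
  by (auto simp: int_encode_def sum_encode_def)

lemma num_vars_le_poly_code: "p \<le> poly_code p D"
  unfolding poly_code_def by (rule le_prod_encode_1)

lemma term_code_less_poly_code:
  assumes "m \<in> keys D" shows "term_code p D m < poly_code p D"
proof -
  have "term_code p D m < list_encode (sorted_list_of_set (term_code p D ` keys D))"
    using assms by (intro member_less_list_encode) simp
  also have "\<dots> \<le> poly_code p D"
    unfolding poly_code_def by (rule le_prod_encode_2)
  finally show ?thesis .
qed

lemma card_keys_le_poly_code:
  assumes "D \<in> polys p" shows "card (keys D) \<le> poly_code p D"
proof -
  have "card (keys D) = card (term_code p D ` keys D)"
    using card_image[OF inj_on_term_code[OF assms]] by simp
  also have "\<dots> \<le> card {..<poly_code p D}"
    using term_code_less_poly_code by (intro card_mono) auto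
  finally show ?thesis by simp
qed

lemma exponent_le_poly_code:
  assumes "m \<in> keys D" "i \<in> {1..p}" shows "lookup m i \<le> poly_code p D"
proof -
  have "lookup m i < list_encode (exponents p m)"
    using assms by (intro member_less_list_encode) (auto simp: exponents_def simp del: upt_Suc)
  also have "\<dots> \<le> term_code p D m"
    unfolding term_code_exponents by (rule le_prod_encode_1)
  finally show ?thesis using term_code_less_poly_code[OF assms(1), of p] by simp
qed

lemma coefficient_le_poly_code:
  assumes "m \<in> keys D" shows "nat \<bar>lookup D m\<bar> \<le> poly_code p D"
proof -
  have "nat \<bar>lookup D m\<bar> \<le> int_encode (lookup D m)" by (rule abs_le_int_encode)
  also have "\<dots> \<le> term_code p D m"
    unfolding term_code_exponents by (rule le_prod_encode_2)
  finally show ?thesis using term_code_less_poly_code[OF assms, of p] by simp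
qed

text \<open>Summing the terms one by one, with powers as iterated products and coefficients as iterated sums
  of \<open>1\<close>, already gives a size that is cubic in the code.\<close>
lemma expressible_eval_poly:
  assumes D: "D \<in> polys p" and q: "p \<le> q" and c: "c = poly_code p D"
  shows "expressible q (3 + c * (c * c + 4 * c + 10)) (eval_poly D)"
proof -
  have "expressible q (c * c + 4 * c + 9) (\<lambda>x. lookup D m * (\<Prod>i\<in>keys m. x i ^ lookup m i))"
    if m: "m \<in> keys D" for m
  proof -
    have sub: "keys m \<subseteq> {1..p}" using D m by (auto simp: polys_def)
    then have card: "card (keys m) \<le> c"
      using card_mono[OF _ sub] num_vars_le_poly_code[of p D] c by simp
    have "expressible q (1 + c) (\<lambda>x. x i ^ lookup m i)" if "i \<in> keys m" for i
    proof -
      have i: "i \<in> {1..p}" using sub that by auto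
      then have "expressible q (1 + lookup m i * (0 + 1)) (\<lambda>x. x i ^ lookup m i)"
        using q by (intro expressible_power var) auto
      then show ?thesis
        by (rule expressible_mono) (use exponent_le_poly_code[OF m i] c in simp)
    qed
    then have "expressible q (1 + card (keys m) * (1 + c + 1)) (\<lambda>x. \<Prod>i\<in>keys m. x i ^ lookup m i)"
      by (intro expressible_prod) auto
    moreover have "expressible q (2 * c + 7) (\<lambda>_. lookup D m)"
      using coefficient_le_poly_code[OF m, of p] c by (intro expressible_const) simp
    moreover have "card (keys m) * (1 + c + 1) \<le> c * (1 + c + 1)"
      using card by (rule mult_le_mono1)
    ultimately show ?thesis
      by (intro mult[of q "2 * c + 7" _ "1 + card (keys m) * (1 + c + 1)"]) (auto simp: algebra_simps)
  qed
  then have "expressible q (3 + card (keys D) * (c * c + 4 * c + 9 + 1)) (eval_poly D)"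
    unfolding eval_poly_def[abs_def] by (intro expressible_sum) auto
  then show ?thesis
    by (rule expressible_mono)
      (intro add_left_mono mult_le_mono, use card_keys_le_poly_code[OF D] c in auto)
qed

lemma eval_poly_cong:
  assumes "D \<in> polys p" "\<And>i. i \<in> {1..p} \<Longrightarrow> x i = y i"
  shows "eval_poly D x = eval_poly D y"
  using expressible_cong[OF expressible_eval_poly[OF assms(1) order_refl refl]] assms(2) by blast

section \<open>Large zeros under Conjecture (T)\<close>

lemma infinite_zeros_imp_large:
  assumes "infinite (zeros p R D)"
  shows "\<exists>x\<in>zeros p R D. \<exists>i\<in>{1..p}. \<bar>x i\<bar> > B"
proof (rule ccontr)
  assume "\<not> ?thesis"
  then have small: "\<bar>x i\<bar> \<le> B" if "x \<in> zeros p R D" "i \<in> {1..p}" for x i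
    using that by (meson not_less)
  have "zeros p R D \<subseteq> {1..p} \<rightarrow>\<^sub>E {- B..B}"
  proof
    fix x assume x: "x \<in> zeros p R D"
    have "x i \<in> {- B..B}" if "i \<in> {1..p}" for i
      using small[OF x that] by (simp add: abs_le_iff minus_le_iff)
    moreover have "x \<in> extensional {1..p}" using x by (simp add: zeros_def PiE_def)
    ultimately show "x \<in> {1..p} \<rightarrow>\<^sub>E {- B..B}" by (simp add: PiE_iff)
  qed
  moreover have "finite ({1..p} \<rightarrow>\<^sub>E {- B..B})" by (intro finite_PiE) auto
  ultimately show False using assms finite_subset by blast
qed

text \<open>A convenient common bound for the number of variables of the systems that belong to integer and
  to non-negative zeros.\<close>
definition size_bound :: "nat \<Rightarrow> nat" where
  "size_bound c = 2 * (c + 5) ^ 3"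

lemma large_integer_zero_imp_infinite:
  assumes T: Conjecture_T and D: "D \<in> polys p" and x: "x \<in> zeros p UNIV D"
    and i: "i \<in> {1..p}" and large: "\<bar>x i\<bar> > 2 ^ (2 ^ size_bound (poly_code p D))"
  shows "infinite (zeros p UNIV D)"
proof -
  define c where "c = poly_code p D"
  have "p + (3 + c * (c * c + 4 * c + 10)) \<le> c + (3 + c * (c * c + 4 * c + 10))"
    using num_vars_le_poly_code[of p D] c_def by simp
  also have "\<dots> \<le> size_bound c"
    by (simp add: size_bound_def power3_eq_cube algebra_simps)
  finally have "(2::int) ^ (2 ^ (p + (3 + c * (c * c + 4 * c + 10)))) \<le> 2 ^ (2 ^ size_bound c)"
    by (intro power_increasing) auto
  then have "\<bar>x i\<bar> > 2 ^ (2 ^ (p + (3 + c * (c * c + 4 * c + 10))))"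
    using large[folded c_def] by (rule le_less_trans)
  moreover have "eval_poly D x = 0" using x by (simp add: zeros_def)
  ultimately show ?thesis
    unfolding zeros_def
    using large_zero_imp_infinite[OF T expressible_eval_poly[OF D order_refl c_def] _ i] by blast
qed

text \<open>Over the integers, a sum of squares vanishes only if each of them does, so this one function
  expresses \<open>D(x\<^sub>1, \<dots>, x\<^sub>p) = 0\<close> together with \<open>p\<close> representations by four squares. The roots for
  \<open>x\<^sub>i\<close> are the variables with indices \<open>p + i\<close>, \<open>2 * p + i\<close>, \<open>3 * p + i\<close> and \<open>4 * p + i\<close>. The variables
  \<open>x\<^sub>i\<close> themselves are kept, so that a large entry of the zero of \<open>D\<close> remains visible.\<close>
definition nonneg_system :: "nat \<Rightarrow> int_mpoly \<Rightarrow> (nat \<Rightarrow> int) \<Rightarrow> int" where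
  "nonneg_system p D x = eval_poly D x * eval_poly D x +
     (\<Sum>i\<in>{1..p}. (x i - ((x (p + i) * x (p + i) + x (2 * p + i) * x (2 * p + i)) +
        (x (3 * p + i) * x (3 * p + i) + x (4 * p + i) * x (4 * p + i)))) ^ 2)"

lemma nonneg_system_eq_0_iff:
  "nonneg_system p D x = 0 \<longleftrightarrow> eval_poly D x = 0 \<and>
     (\<forall>i\<in>{1..p}. x i = (x (p + i))\<^sup>2 + (x (2 * p + i))\<^sup>2 + (x (3 * p + i))\<^sup>2 + (x (4 * p + i))\<^sup>2)"
  unfolding nonneg_system_def
  by (subst add_nonneg_eq_0_iff) (auto intro!: sum_nonneg simp: sum_nonneg_eq_0_iff power2_eq_square)

lemma expressible_nonneg_system:
  assumes D: "D \<in> polys p" and c: "c = poly_code p D"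
  shows "expressible (5 * p) (2 * (3 + c * (c * c + 4 * c + 10)) + 23 * c + 6) (nonneg_system p D)"
proof -
  have "expressible (5 * p) 18 (\<lambda>x. (x i - ((x (p + i) * x (p + i) + x (2 * p + i) * x (2 * p + i)) +
        (x (3 * p + i) * x (3 * p + i) + x (4 * p + i) * x (4 * p + i)))) ^ 2)"
    if i: "i \<in> {1..p}" for i
  proof -
    \<comment> \<open>\<open>x\<^sub>i\<close> and its four roots are the variables at positions \<open>i\<close> of the blocks \<open>r = 0, \<dots>, 4\<close>.\<close>
    have v: "expressible (5 * p) 0 (\<lambda>x. x (r * p + i))" if "r \<le> 4" for r
    proof (rule var)
      have "1 \<le> i" "i \<le> p" using i by auto
      then show "r * p + i \<in> {1..5 * p}"
        using mult_le_mono1[OF that, of p] unfolding atLeastAtMost_iff by linarith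
    qed
    have sq: "expressible (5 * p) 1 (\<lambda>x. x (r * p + i) * x (r * p + i))" if "r \<le> 4" for r
      by (rule mult[OF v v]) (use that in auto)
    have two: "expressible (5 * p) 3 (\<lambda>x. x (r * p + i) * x (r * p + i) + x (s * p + i) * x (s * p + i))"
      if "r \<le> 4" "s \<le> 4" for r s
      by (rule add[OF sq sq]) (use that in auto)
    have "expressible (5 * p) 8 (\<lambda>x. x (0 * p + i) - ((x (1 * p + i) * x (1 * p + i) + x (2 * p + i) * x (2 * p + i)) +
        (x (3 * p + i) * x (3 * p + i) + x (4 * p + i) * x (4 * p + i))))"
      by (rule diff[OF v add[OF two two order_refl]]) auto
    from mult[OF this this, of 18] show ?thesis by (simp add: power2_eq_square)
  qed
  then have sum: "expressible (5 * p) (3 + card {1..p} * (18 + 1)) (\<lambda>x. \<Sum>i\<in>{1..p}. (x i - ((x (p + i) * x (p + i) + x (2 * p + i) * x (2 * p + i)) +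
        (x (3 * p + i) * x (3 * p + i) + x (4 * p + i) * x (4 * p + i)))) ^ 2)"
    by (intro expressible_sum) auto
  have square: "expressible (5 * p) (2 * (3 + c * (c * c + 4 * c + 10)) + 1) (\<lambda>x. eval_poly D x * eval_poly D x)"
    by (rule mult[OF expressible_eval_poly expressible_eval_poly]) (use D c in auto)
  show ?thesis
    unfolding nonneg_system_def[abs_def]
    by (rule add[OF square sum]) (use num_vars_le_poly_code[of p D] c in auto)
qed

text \<open>If there were only finitely many non-negative zeros of \<open>D\<close>, some number \<open>M\<close> would bound all their
  entries. An integer whose square is at most \<open>M\<close> is itself at most \<open>M\<close> in absolute value, so the
  zeros of the enlarged system would be bounded too. This contradicts the infinity of their set.\<close>
lemma large_nonneg_zero_imp_infinite:
  assumes T: Conjecture_T and D: "D \<in> polys p" and x: "x \<in> zeros p {0..} D"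
    and i: "i \<in> {1..p}" and large: "\<bar>x i\<bar> > 2 ^ (2 ^ size_bound (poly_code p D))"
  shows "infinite (zeros p {0..} D)"
proof
  assume fin: "finite (zeros p {0..} D)"
  define c where "c = poly_code p D"
  have "\<exists>a. x i = (a (1::nat))\<^sup>2 + (a 2)\<^sup>2 + (a 3)\<^sup>2 + (a 4)\<^sup>2" if i: "i \<in> {1..p}" for i
  proof -
    have "x i = int (nat (x i))" using x i by (auto simp: zeros_def)
    then obtain u v w t where "x i = u\<^sup>2 + v\<^sup>2 + w\<^sup>2 + t\<^sup>2"
      using lagrange_four_squares[of "nat (x i)"] unfolding four_squares_def by metis
    then show ?thesis by (intro exI[of _ "((\<lambda>_. t)(1 := u, 2 := v, 3 := w))"]) simp
  qed
  then obtain a where a: "\<And>i. i \<in> {1..p} \<Longrightarrow>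
      x i = (a i (1::nat))\<^sup>2 + (a i 2)\<^sup>2 + (a i 3)\<^sup>2 + (a i 4)\<^sup>2"
    by metis
  \<comment> \<open>The zero of \<open>D\<close>, extended by the four blocks of roots.\<close>
  define z where "z j = (if j \<le> p then x j else if j \<le> 2 * p then a (j - p) 1
    else if j \<le> 3 * p then a (j - 2 * p) 2 else if j \<le> 4 * p then a (j - 3 * p) 3
    else a (j - 4 * p) 4)" for j
  have "eval_poly D z = 0"
    using eval_poly_cong[OF D, of z x] x by (simp add: z_def zeros_def)
  then have z0: "nonneg_system p D z = 0"
    unfolding nonneg_system_eq_0_iff using a by (auto simp: z_def)
  have "5 * p + (2 * (3 + c * (c * c + 4 * c + 10)) + 23 * c + 6) \<le>
      5 * c + (2 * (3 + c * (c * c + 4 * c + 10)) + 23 * c + 6)"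
    using num_vars_le_poly_code[of p D] c_def by simp
  also have "\<dots> \<le> size_bound c"
    by (simp add: size_bound_def power3_eq_cube algebra_simps)
  finally have "(2::int) ^ (2 ^ (5 * p + (2 * (3 + c * (c * c + 4 * c + 10)) + 23 * c + 6)))
      \<le> 2 ^ (2 ^ size_bound c)"
    by (intro power_increasing) auto
  also have "\<dots> < \<bar>z i\<bar>"
    using large i by (simp add: z_def c_def)
  finally have "\<bar>z i\<bar> > 2 ^ (2 ^ (5 * p + (2 * (3 + c * (c * c + 4 * c + 10)) + 23 * c + 6)))" .
  moreover have "i \<in> {1..5 * p}" using i by simp
  ultimately have inf: "infinite {z \<in> {1..5 * p} \<rightarrow>\<^sub>E UNIV. nonneg_system p D z = 0}"
    using large_zero_imp_infinite[OF T expressible_nonneg_system[OF D c_def] z0] by blast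
  define M where "M = (\<Sum>x\<in>zeros p {0..} D. \<Sum>i\<in>{1..p}. x i)"
  have M: "y i \<le> M" if y: "y \<in> zeros p {0..} D" and i: "i \<in> {1..p}" for y i
  proof -
    have nn: "0 \<le> y i" if "y \<in> zeros p {0..} D" "i \<in> {1..p}" for y i
      using that by (auto simp: zeros_def)
    have "y i \<le> (\<Sum>i\<in>{1..p}. y i)"
      using i y by (intro member_le_sum nn) auto
    also have "\<dots> \<le> M"
      unfolding M_def using fin y by (intro member_le_sum sum_nonneg nn) auto
    finally show ?thesis .
  qed
  have "{z \<in> {1..5 * p} \<rightarrow>\<^sub>E UNIV. nonneg_system p D z = 0} \<subseteq> {1..5 * p} \<rightarrow>\<^sub>E {- M..M}"
  proof
    fix z assume z: "z \<in> {z \<in> {1..5 * p} \<rightarrow>\<^sub>E UNIV. nonneg_system p D z = 0}"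
    then have z0: "eval_poly D z = 0" and zsq: "\<And>i. i \<in> {1..p} \<Longrightarrow>
        z i = (z (p + i))\<^sup>2 + (z (2 * p + i))\<^sup>2 + (z (3 * p + i))\<^sup>2 + (z (4 * p + i))\<^sup>2"
      by (auto simp: nonneg_system_eq_0_iff)
    have "restrict z {1..p} \<in> zeros p {0..} D"
      using z0 zsq eval_poly_cong[OF D, of "restrict z {1..p}" z] by (auto simp: zeros_def)
    from M[OF this] have zM: "z i \<le> M" if "i \<in> {1..p}" for i using that by simp
    have abs_le: "\<bar>t\<bar> \<le> M" if "t\<^sup>2 \<le> M" for t
    proof -
      have "\<bar>t\<bar> * 1 \<le> \<bar>t\<bar> * \<bar>t\<bar>" if "t \<noteq> 0"
        using that by (intro mult_left_mono) auto
      then have "\<bar>t\<bar> \<le> t\<^sup>2" by (cases "t = 0") (simp_all add: power2_eq_square)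
      with that show ?thesis by simp
    qed
    have blocks: "\<bar>z i\<bar> \<le> M \<and> \<bar>z (p + i)\<bar> \<le> M \<and> \<bar>z (2 * p + i)\<bar> \<le> M \<and> \<bar>z (3 * p + i)\<bar> \<le> M \<and> \<bar>z (4 * p + i)\<bar> \<le> M"
      if i: "i \<in> {1..p}" for i
    proof (intro conjI)
      have nn: "0 \<le> (z (p + i))\<^sup>2" "0 \<le> (z (2 * p + i))\<^sup>2" "0 \<le> (z (3 * p + i))\<^sup>2" "0 \<le> (z (4 * p + i))\<^sup>2"
        by simp_all
      show "\<bar>z i\<bar> \<le> M" using zM[OF i] zsq[OF i] nn by linarith
      show "\<bar>z (p + i)\<bar> \<le> M" by (rule abs_le) (use zM[OF i] zsq[OF i] nn in linarith)
      show "\<bar>z (2 * p + i)\<bar> \<le> M" by (rule abs_le) (use zM[OF i] zsq[OF i] nn in linarith)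
      show "\<bar>z (3 * p + i)\<bar> \<le> M" by (rule abs_le) (use zM[OF i] zsq[OF i] nn in linarith)
      show "\<bar>z (4 * p + i)\<bar> \<le> M" by (rule abs_le) (use zM[OF i] zsq[OF i] nn in linarith)
    qed
    have "\<bar>z j\<bar> \<le> M" if j: "j \<in> {1..5 * p}" for j
    proof -
      consider "j \<in> {1..p}" | "j - p \<in> {1..p}" "j = p + (j - p)" | "j - 2 * p \<in> {1..p}" "j = 2 * p + (j - 2 * p)"
        | "j - 3 * p \<in> {1..p}" "j = 3 * p + (j - 3 * p)" | "j - 4 * p \<in> {1..p}" "j = 4 * p + (j - 4 * p)"
        using j by fastforce
      then show ?thesis using blocks by cases metis+
    qed
    then show "z \<in> {1..5 * p} \<rightarrow>\<^sub>E {- M..M}"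
      using z by (auto simp: PiE_iff abs_le_iff minus_le_iff)
  qed
  moreover have "finite ({1..5 * p} \<rightarrow>\<^sub>E {- M..M})" by (intro finite_PiE) auto
  ultimately show False using inf finite_subset by blast
qed

section \<open>Polynomials as lists of terms\<close>

type_synonym term_list = "(nat list \<times> int) list"

text \<open>A fold over the exponents that consumes the list of values in parallel, which fits the closure
  rules for computable functions.\<close>
definition monomial_value :: "nat list \<Rightarrow> int list \<Rightarrow> int" where
  "monomial_value es xs = snd (foldl (\<lambda>st e. case fst st of [] \<Rightarrow> st | y # ys \<Rightarrow> (ys, snd st * y ^ e)) (xs, 1) es)"

lemma monomial_value:
  assumes "length xs = length es"
  shows "monomial_value es xs = (\<Prod>i<length es. xs ! i ^ (es ! i))"
proof -
  have "length xs = length es \<Longrightarrow>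
    snd (foldl (\<lambda>st e. case fst st of [] \<Rightarrow> st | y # ys \<Rightarrow> (ys, snd st * y ^ e)) (xs, a) es) =
    a * (\<Prod>i<length es. xs ! i ^ (es ! i))" for a
  proof (induction es arbitrary: xs a)
    case (Cons e es)
    then obtain y ys where "xs = y # ys" by (cases xs) auto
    with Cons show ?case by (simp add: prod.lessThan_Suc_shift mult.assoc del: prod.lessThan_Suc)
  qed simp
  then show ?thesis using assms by (simp add: monomial_value_def)
qed

definition terms_value :: "term_list \<Rightarrow> int list \<Rightarrow> int" where
  "terms_value ts xs = foldl (\<lambda>s t. s + snd t * monomial_value (fst t) xs) 0 ts"

lemma terms_value: "terms_value ts xs = (\<Sum>t\<leftarrow>ts. snd t * monomial_value (fst t) xs)"
proof -
  have "foldl (\<lambda>s t. s + snd t * monomial_value (fst t) xs) s ts = s + (\<Sum>t\<leftarrow>ts. snd t * monomial_value (fst t) xs)" for s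
    by (induction ts arbitrary: s) auto
  then show ?thesis by (simp add: terms_value_def)
qed

lemma computable_monomial_value [computable]:
  assumes "computable f" "computable g" shows "computable (\<lambda>x. monomial_value (f x) (g x))"
  unfolding monomial_value_def by (intro computable assms)

lemma computable_terms_value [computable]:
  assumes "computable f" "computable g" shows "computable (\<lambda>x. terms_value (f x) (g x))"
  unfolding terms_value_def by (intro computable assms computable_comp[OF assms(2)])

definition code_sorted :: "'a::codable list \<Rightarrow> bool" where
  "code_sorted ts \<longleftrightarrow> sorted_wrt (<) (map code ts)"

text \<open>The state of the fold is \<open>0\<close> after a violation of the order, and otherwise one more than the least
  code that the next element may have.\<close>
lemma decidable_code_sorted [computable]:
  assumes "computable f" shows "decidable (\<lambda>x. code_sorted (f x))"
proof -
  let ?F = "foldl (\<lambda>s t. if 0 < s \<and> s \<le> Suc (code t) then Suc (Suc (code t)) else 0)"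
  have 0: "?F 0 ts = 0" for ts :: "'b list" by (induction ts) auto
  have "?F (Suc s) ts \<noteq> 0 \<longleftrightarrow> sorted_wrt (<) (map code ts) \<and> (\<forall>t\<in>set ts. s \<le> code t)" for s and ts :: "'b list"
    by (induction ts arbitrary: s) (auto simp: 0 Suc_le_eq dest: less_imp_le_nat)
  from this[of 0] have "code_sorted ts \<longleftrightarrow> \<not> ?F 1 ts = 0" for ts :: "'b list"
    by (simp add: code_sorted_def)
  moreover have "decidable (\<lambda>x. \<not> ?F 1 (f x) = 0)"
    by (intro computable assms)
  ultimately show ?thesis by simp
qed

text \<open>These are exactly the lists of terms of polynomials in \<open>p\<close> variables. The last condition excludes
  repeated monomials with different coefficients; equal terms are excluded by the strict order.\<close>
definition valid_terms :: "nat \<Rightarrow> term_list \<Rightarrow> bool" where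
  "valid_terms p ts \<longleftrightarrow> code_sorted ts \<and> (\<forall>t\<in>set ts. length (fst t) = p \<and> snd t \<noteq> 0) \<and>
     (\<forall>t\<in>set ts. \<forall>u\<in>set ts. fst t = fst u \<longrightarrow> t = u)"

lemma decidable_valid_terms [computable]:
  assumes "computable f" "computable g" shows "decidable (\<lambda>x. valid_terms (f x) (g x))"
  unfolding valid_terms_def
  by (intro computable assms computable_comp[OF assms(1)] computable_comp[OF assms(2)])

lemma code_exponents: "code (exponents p m, lookup D m) = term_code p D m"
  by (simp add: term_code_exponents code_list_def code_int_def map_idI)

definition represents :: "nat \<Rightarrow> term_list \<Rightarrow> int_mpoly \<Rightarrow> bool" where
  "represents p ts D \<longleftrightarrow> set ts = (\<lambda>m. (exponents p m, lookup D m)) ` keys D \<and> code_sorted ts"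

lemma represents_map_code:
  assumes "represents p ts D"
  shows "map code ts = sorted_list_of_set (term_code p D ` keys D)"
proof -
  have "set (map code ts) = term_code p D ` keys D"
    using assms by (simp add: represents_def image_image code_exponents del: code_Pair)
  moreover have "sorted_wrt (<) (map code ts)"
    using assms by (simp add: represents_def code_sorted_def)
  ultimately show ?thesis
    by (metis sorted_list_of_set.idem_if_sorted_distinct strict_sorted_iff)
qed

lemma poly_code_represents:
  assumes "represents p ts D" shows "poly_code p D = code (p, ts)"
  using represents_map_code[OF assms] by (simp add: poly_code_def code_list_def)

lemma represents_exists: "\<exists>ts. represents p ts D"
proof -
  let ?L = "sorted_list_of_set (term_code p D ` keys D)"
  let ?ts = "map (inv code) ?L :: term_list"
  have code: "code (inv code n :: nat list \<times> int) = n" for n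
    by (rule surj_f_inv_f[OF bij_is_surj[OF bij_code]])
  have decode: "inv code (code t) = t" for t :: "nat list \<times> int"
    by (rule inv_f_f[OF bij_is_inj[OF bij_code]])
  have "map code ?ts = ?L" by (simp add: comp_def code)
  then have "code_sorted ?ts" by (simp add: code_sorted_def)
  moreover have "set ?ts = (\<lambda>m. (exponents p m, lookup D m)) ` keys D"
    by (simp add: image_image decode del: code_Pair flip: code_exponents)
  ultimately show ?thesis unfolding represents_def by blast
qed

lemma valid_terms_represents:
  assumes D: "D \<in> polys p" and ts: "represents p ts D" shows "valid_terms p ts"
proof -
  have "t = u" if t: "t \<in> set ts" and u: "u \<in> set ts" and eq: "fst t = fst u" for t u
  proof -
    obtain m m' where m: "m \<in> keys D" "t = (exponents p m, lookup D m)"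
        "m' \<in> keys D" "u = (exponents p m', lookup D m')"
      using t u ts by (auto simp: represents_def)
    then have "m = m'"
      using eq D by (intro inj_onD[OF inj_on_exponents[of p]]) (auto simp: polys_def)
    with m show ?thesis by simp
  qed
  then show ?thesis
    using ts by (auto simp: valid_terms_def represents_def length_exponents in_keys_iff)
qed

lemma code_sorted_distinct: "code_sorted ts \<Longrightarrow> distinct ts"
  unfolding code_sorted_def by (metis strict_sorted_iff distinct_map)

lemma monomial_with_exponents:
  obtains m where "keys m \<subseteq> {1..length es}" "exponents (length es) m = es"
proof
  define f where "f i = (if i \<in> {1..length es} then es ! (i - 1) else 0)" for i
  have "finite {i. f i \<noteq> 0}" by (rule finite_subset[of _ "{1..length es}"]) (auto simp: f_def)
  then have f: "lookup (Abs_poly_mapping f) = f" by simp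
  show "keys (Abs_poly_mapping f) \<subseteq> {1..length es}"
    by (rule subsetI) (auto simp: in_keys_iff f f_def split: if_splits)
  show "exponents (length es) (Abs_poly_mapping f) = es"
    by (rule nth_equalityI) (auto simp: length_exponents nth_exponents f f_def)
qed

text \<open>The coefficient of a monomial is found by looking up its exponents in the list. Its support is
  finite, since a monomial in \<open>p\<close> variables is determined by its exponents.\<close>
lemma valid_terms_imp_represents:
  assumes "valid_terms p ts"
  obtains D where "D \<in> polys p" "represents p ts D"
proof
  have "distinct ts" "inj_on fst (set ts)"
    using assms by (auto simp: valid_terms_def code_sorted_distinct intro: inj_onI)
  then have dist: "distinct (map fst ts)" by (simp add: distinct_map)
  define f where "f m = (if keys m \<subseteq> {1..p} then case map_of ts (exponents p m) of None \<Rightarrow> 0 | Some a \<Rightarrow> a else 0)"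
    for m
  have "{m. f m \<noteq> 0} \<subseteq> exponents p -` (fst ` set ts) \<inter> {m. keys m \<subseteq> {1..p}}"
    by (auto simp: f_def simp flip: dom_map_of_conv_image_fst split: if_splits option.splits)
  then have "finite {m. f m \<noteq> 0}"
    by (rule finite_subset) (intro finite_vimage_IntI inj_on_exponents, simp)
  then have f: "lookup (Abs_poly_mapping f) = f" by simp
  let ?D = "Abs_poly_mapping f"
  have keys: "keys ?D = {m. f m \<noteq> 0}" by (simp add: set_eq_iff in_keys_iff f)
  show "?D \<in> polys p"
    unfolding polys_def mem_Collect_eq
  proof
    fix m assume "m \<in> keys ?D"
    then have "f m \<noteq> 0" by (simp add: keys)
    then show "keys m \<subseteq> {1..p}" by (simp add: f_def split: if_splits)
  qed
  have "(exponents p m, f m) \<in> set ts" if "f m \<noteq> 0" for m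
    using that by (auto simp: f_def split: if_splits option.splits dest: map_of_SomeD)
  moreover have "\<exists>m. f m \<noteq> 0 \<and> t = (exponents p m, f m)" if t: "t \<in> set ts" for t
  proof -
    obtain m where m: "keys m \<subseteq> {1..length (fst t)}" "exponents (length (fst t)) m = fst t"
      by (rule monomial_with_exponents)
    have "length (fst t) = p" "snd t \<noteq> 0" using assms t by (auto simp: valid_terms_def)
    moreover have "map_of ts (fst t) = Some (snd t)"
      using dist t by (simp add: map_of_is_SomeI)
    ultimately have "f m = snd t" using m by (simp add: f_def)
    then show ?thesis using m \<open>length (fst t) = p\<close> \<open>snd t \<noteq> 0\<close> by (metis prod.collapse)
  qed
  ultimately have "set ts = (\<lambda>m. (exponents p m, lookup ?D m)) ` keys ?D"
    by (auto simp: f keys image_iff)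
  then show "represents p ts ?D"
    using assms unfolding represents_def valid_terms_def by blast
qed

lemma terms_value_represents:
  assumes D: "D \<in> polys p" and ts: "represents p ts D" and xs: "length xs = p"
  shows "terms_value ts xs = eval_poly D (\<lambda>i. xs ! (i - 1))"
proof -
  have mono: "monomial_value (exponents p m) xs = (\<Prod>i\<in>keys m. xs ! (i - 1) ^ lookup m i)"
    if m: "m \<in> keys D" for m
  proof -
    have "monomial_value (exponents p m) xs = (\<Prod>i<p. xs ! i ^ lookup m (Suc i))"
      using xs by (simp add: monomial_value length_exponents nth_exponents)
    also have "\<dots> = (\<Prod>i\<in>{1..p}. xs ! (i - 1) ^ lookup m i)"
      by (rule prod.reindex_bij_witness[of _ "\<lambda>i. i - 1" Suc]) auto
    also have "\<dots> = (\<Prod>i\<in>keys m. xs ! (i - 1) ^ lookup m i)"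
      using D m by (intro prod.mono_neutral_right) (auto simp: polys_def in_keys_iff)
    finally show ?thesis .
  qed
  have inj: "inj_on (\<lambda>m. (exponents p m, lookup D m)) (keys D)"
    using D by (intro inj_onI inj_onD[OF inj_on_exponents[of p]]) (auto simp: polys_def)
  have "distinct ts" using ts by (simp add: represents_def code_sorted_distinct)
  then have "terms_value ts xs = (\<Sum>t\<in>set ts. snd t * monomial_value (fst t) xs)"
    unfolding terms_value by (rule sum_list_distinct_conv_sum_set)
  also have "\<dots> = (\<Sum>m\<in>keys D. lookup D m * monomial_value (exponents p m) xs)"
    using ts inj by (simp add: represents_def sum.reindex)
  also have "\<dots> = eval_poly D (\<lambda>i. xs ! (i - 1))"
    unfolding eval_poly_def by (rule sum.cong) (simp_all add: mono)
  finally show ?thesis .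
qed

text \<open>Quantification over the zeros, which are functions, becomes quantification over lists, which have
  codes. Variable \<open>x\<^sub>i\<close> is at position \<open>i - 1\<close>.\<close>
lemma large_zero_list_iff:
  assumes D: "D \<in> polys p" and ts: "represents p ts D"
  shows "(\<exists>x\<in>zeros p R D. \<exists>i\<in>{1..p}. \<bar>x i\<bar> > B) \<longleftrightarrow>
    (\<exists>xs. length xs = p \<and> set xs \<subseteq> R \<and> terms_value ts xs = 0 \<and> (\<exists>a\<in>set xs. \<bar>a\<bar> > B))"
proof
  assume "\<exists>x\<in>zeros p R D. \<exists>i\<in>{1..p}. \<bar>x i\<bar> > B"
  then obtain x i where x: "x \<in> zeros p R D" and i: "i \<in> {1..p}" "\<bar>x i\<bar> > B" by blast
  let ?xs = "map x [1..<Suc p]"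
  have nth: "?xs ! (i - 1) = x i" if "i \<in> {1..p}" for i
    using that nth_map_upt[of "i - 1" "Suc p" 1 x] by auto
  have set: "set ?xs = x ` {1..p}" by auto
  have "eval_poly D (\<lambda>i. ?xs ! (i - 1)) = 0"
    using x eval_poly_cong[OF D nth] by (simp add: zeros_def)
  then have "terms_value ts ?xs = 0" by (subst terms_value_represents[OF D ts]) auto
  moreover have "length ?xs = p" by simp
  moreover have "set ?xs \<subseteq> R" unfolding set using x by (auto simp: zeros_def)
  moreover have "\<exists>a\<in>set ?xs. \<bar>a\<bar> > B" unfolding set using i by blast
  ultimately show "\<exists>xs. length xs = p \<and> set xs \<subseteq> R \<and> terms_value ts xs = 0 \<and> (\<exists>a\<in>set xs. \<bar>a\<bar> > B)"
    by blast
next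
  assume "\<exists>xs. length xs = p \<and> set xs \<subseteq> R \<and> terms_value ts xs = 0 \<and> (\<exists>a\<in>set xs. \<bar>a\<bar> > B)"
  then obtain xs j where xs: "length xs = p" "set xs \<subseteq> R" "terms_value ts xs = 0"
    and j: "j < p" "\<bar>xs ! j\<bar> > B" by (auto simp: in_set_conv_nth)
  let ?x = "restrict (\<lambda>i. xs ! (i - 1)) {1..p}"
  have "eval_poly D ?x = eval_poly D (\<lambda>i. xs ! (i - 1))"
    by (rule eval_poly_cong[OF D]) simp
  also have "\<dots> = 0" using xs terms_value_represents[OF D ts] by simp
  finally have "eval_poly D ?x = 0" .
  moreover have "xs ! (i - 1) \<in> R" if "i \<in> {1..p}" for i
    using that xs nth_mem[of "i - 1" xs] by auto
  ultimately have "?x \<in> zeros p R D" by (auto simp: zeros_def)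
  moreover have "Suc j \<in> {1..p}" "\<bar>?x (Suc j)\<bar> > B" using j by auto
  ultimately show "\<exists>x\<in>zeros p R D. \<exists>i\<in>{1..p}. \<bar>x i\<bar> > B" by blast
qed

lemma computable_size_bound [computable]:
  assumes "computable f" shows "computable (\<lambda>x. size_bound (f x))"
  unfolding size_bound_def by (intro computable assms)

text \<open>The predicate \<open>K\<close> selects the admissible values of the variables, so that integer and non-negative
  zeros are treated alike. The second hypothesis replaces the infinity of a set, which no finite
  amount of data can confirm, by the existence of a single large zero.\<close>
lemma rec_enumerable_infinite_zeros:
  assumes K: "decidable K"
    and iff: "\<And>p D. D \<in> polys p \<Longrightarrow> infinite (zeros p {a. K a} D) \<longleftrightarrow>
      (\<exists>x\<in>zeros p {a. K a} D. \<exists>i\<in>{1..p}. \<bar>x i\<bar> > 2 ^ (2 ^ size_bound (poly_code p D)))"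
  shows "rec_enumerable {poly_code p D | p D. p \<ge> 1 \<and> D \<in> polys p \<and> infinite (zeros p {a. K a} D)}"
proof -
  define search :: "nat \<times> term_list \<Rightarrow> int list \<Rightarrow> bool" where
    "search y xs \<longleftrightarrow> 1 \<le> fst y \<and> valid_terms (fst y) (snd y) \<and> length xs = fst y \<and>
       (\<forall>a\<in>set xs. K a) \<and> terms_value (snd y) xs = 0 \<and>
       (\<exists>a\<in>set xs. 2 ^ (2 ^ size_bound (code y)) < nat a + nat (- a))" for y xs
  \<comment> \<open>The absolute value, composed of operations with closure rules for computability.\<close>
  have large: "2 ^ b < nat a + nat (- a) \<longleftrightarrow> (2::int) ^ b < \<bar>a\<bar>" for a b
  proof -
    have "nat a + nat (- a) = nat \<bar>a\<bar>" by simp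
    then show ?thesis by (simp add: zless_nat_eq_int_zless)
  qed
  have search: "(\<exists>xs. search (p, ts) xs) \<longleftrightarrow> infinite (zeros p {a. K a} D)"
    if "1 \<le> p" "D \<in> polys p" "represents p ts D" for p ts D
    unfolding iff[OF that(2)] large_zero_list_iff[OF that(2,3)] poly_code_represents[OF that(3)]
    using that valid_terms_represents[OF that(2,3)]
    by (auto simp: search_def large subset_iff)
  have "{poly_code p D | p D. p \<ge> 1 \<and> D \<in> polys p \<and> infinite (zeros p {a. K a} D)} =
      {code y | y. \<exists>xs. search y xs}" (is "?A = ?B")
  proof
    show "?A \<subseteq> ?B"
    proof clarify
      fix p D assume D: "p \<ge> 1" "D \<in> polys p" "infinite (zeros p {a. K a} D)"
      obtain ts where ts: "represents p ts D" using represents_exists by blast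
      then have "\<exists>xs. search (p, ts) xs" using search D by blast
      then show "\<exists>y. poly_code p D = code y \<and> (\<exists>xs. search y xs)"
        using poly_code_represents[OF ts] by blast
    qed
    show "?B \<subseteq> ?A"
    proof clarify
      fix p ts xs assume xs: "search (p, ts) xs"
      then have p: "1 \<le> p" and "valid_terms p ts" by (auto simp: search_def)
      then obtain D where D: "D \<in> polys p" "represents p ts D"
        using valid_terms_imp_represents by blast
      then have "infinite (zeros p {a. K a} D)" using search[OF p D] xs by blast
      then show "\<exists>p' D. code (p, ts) = poly_code p' D \<and> p' \<ge> 1 \<and> D \<in> polys p' \<and> infinite (zeros p' {a. K a} D)"
        using p D poly_code_represents by metis
    qed
  qed
  moreover have "decidable (\<lambda>z. search (fst z) (snd z))"
    unfolding search_def by (intro computable decidable_comp[OF K])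
  ultimately show ?thesis using rec_enumerable_projection[of search] by simp
qed

theorem theorem7:
  assumes "Conjecture_T"
  shows "rec_enumerable
           {poly_code p D | p D. p \<ge> 1 \<and> D \<in> polys p \<and> infinite (zeros p UNIV D)}
       \<and> rec_enumerable
           {poly_code p D | p D. p \<ge> 1 \<and> D \<in> polys p \<and> infinite (zeros p {0..} D)}"
proof
  have iff: "infinite (zeros p UNIV D) \<longleftrightarrow>
      (\<exists>x\<in>zeros p UNIV D. \<exists>i\<in>{1..p}. \<bar>x i\<bar> > 2 ^ (2 ^ size_bound (poly_code p D)))"
    if "D \<in> polys p" for p D
    using infinite_zeros_imp_large large_integer_zero_imp_infinite[OF assms that] by blast
  have "{a::int. True} = UNIV" by simp
  from rec_enumerable_infinite_zeros[of "\<lambda>_. True", unfolded this, OF decidable_const iff]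
  show "rec_enumerable
           {poly_code p D | p D. p \<ge> 1 \<and> D \<in> polys p \<and> infinite (zeros p UNIV D)}" .
next
  have iff: "infinite (zeros p {0..} D) \<longleftrightarrow>
      (\<exists>x\<in>zeros p {0..} D. \<exists>i\<in>{1..p}. \<bar>x i\<bar> > 2 ^ (2 ^ size_bound (poly_code p D)))"
    if "D \<in> polys p" for p D
    using infinite_zeros_imp_large large_nonneg_zero_imp_infinite[OF assms that] by blast
  have dec: "decidable (\<lambda>a::int. nat (- a) = 0)" by (intro computable)
  have "{a::int. nat (- a) = 0} = {0..}" by auto
  from rec_enumerable_infinite_zeros[of "\<lambda>a. nat (- a) = 0", unfolded this, OF dec iff]
  show "rec_enumerable
           {poly_code p D | p D. p \<ge> 1 \<and> D \<in> polys p \<and> infinite (zeros p {0..} D)}" .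
qed

end
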